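(* Let $r$ be an odd positive integer not divisible by any of $3,5,17,257,641,65537,6700417$. Then there exist infinitely many primes $p$ such that $2^{\alpha}p\in G_r$ for all nonnegative integers $\alpha$.
   Context: For a positive integer $r$, the $r$-th Schemmel totient function $S_r:\mathbb{N}\to\mathbb{N}_0$ is the multiplicative arithmetic function (so $S_r(1)=1$ and $S_r(ab)=S_r(a)S_r(b)$ for coprime $a,b$) defined on prime powers by $S_r(p^{\alpha})=0$ if $p\le r$ and $S_r(p^\alpha)=p^{\alpha-1}(p-r)$ if $p>r$, for all primes $p$ and positive integers $\alpha$. $G_r$ denotes the set of positive integers not in the range of $S_r$. *)

theory Defs
  imports "HOL-Computational_Algebra.Primes"
begin

text \<open>Schemmel totient S_r, multiplicative, on prime powers:
  S_r(p^a) = 0 if p <= r, and p^(a-1)(p - r) if p > r. S_r(1) = 1 (empty product).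
  Only meaningful for n > 0.\<close>
definition schemmel :: "nat \<Rightarrow> nat \<Rightarrow> nat" where
  "schemmel r n = (\<Prod>p\<in>prime_factors n.
      (if p \<le> r then 0 else p ^ (multiplicity p n - 1) * (p - r)))"

definition schemmel_G :: "nat \<Rightarrow> nat set" where
  "schemmel_G r = {m. m > 0 \<and> (\<nexists>n. n > 0 \<and> schemmel r n = m)}"

end

theory Submission
  imports Defs "HOL-Analysis.Analysis" "HOL-Number_Theory.Number_Theory" "HOL-Number_Theory.Mod_Exp"
    "HOL-Computational_Algebra.Squarefree" "HOL-Real_Asymp.Real_Asymp"
begin

text \<open>
  If \<open>schemmel r n = 2 ^ \<alpha> * p\<close> for an odd prime \<open>p\<close>, then either some \<open>2 ^ a * p + r\<close> is prime or \<open>p - r\<close> is a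
  power of 2.  Sierpinski's covering of the exponents by the prime factors
  3, 5, 17, 257, 641, 65537, 6700417 of \<open>2 ^ 64 - 1\<close> excludes the first alternative when \<open>p\<close> is large,
  congruent to \<open>- r\<close> modulo 641, and congruent to \<open>r\<close> modulo the other six primes; the congruence modulo 3
  excludes the second.  Infinitely many such \<open>p\<close> exist by Dirichlet's theorem, which is proved here
  for odd moduli by Shapiro's elementary method: the sums of \<open>\<phi> n * mangoldt n / n\<close> over \<open>n \<le> N\<close> are
  compared with \<open>ln N\<close> for every Dirichlet character \<open>\<phi>\<close>.
\<close>

section \<open>Partial summation and divisor sums\<close>

text \<open>The fifth Fermat number is 641 * 6700417, so the Fermat numbers with index below 6
  supply seven primes for the six classes of exponents \<open>a = 2 ^ i * u\<close> with
  \<open>u\<close> odd and \<open>i < 6\<close>; the spare prime 641 takes the multiples of 64. In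
  the six classes \<open>2 ^ a\<close> is -1 modulo the chosen prime, so
  \<open>2 ^ a * p + r\<close> vanishes there when \<open>p\<close> is congruent to
  \<open>r\<close>; modulo 641 the power is 1, hence the opposite sign. Since \<open>r\<close> is
  prime to all seven, these residues are units, as Dirichlet's theorem demands. Oddness of the
  modulus makes the unit group of each of its prime power parts cyclic, so characters separating
  residues can be written down from primitive roots. The number of characters enters only as a
  constant factor and stays unevaluated. The obstacle is \<open>L(1) \<noteq> 0\<close>. Positivity
  of the sum over the residue 1 excludes two vanishing characters but not a single one, which is
  then real; that case needs a separate argument.\<close>

lemma sum_split_at:
  fixes g :: "nat \<Rightarrow> 'a :: comm_monoid_add"
  assumes "M \<le> N"
  shows "(\<Sum>n=1..N. g n) = (\<Sum>n=1..M. g n) + (\<Sum>n=Suc M..N. g n)"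
proof -
  have "{1..N} = {1..M} \<union> {Suc M..N}" using assms by auto
  thus ?thesis by (simp add: sum.union_disjoint)
qed

text \<open>Summation by parts. Monotonicity is asked only beyond \<open>M\<close>, because
  \<open>ln n / n\<close> decreases only from 3 on. The factor 2 arises since a sum starting at
  \<open>Suc M\<close> is a difference of two initial sums.\<close>

lemma abel_summation_bound:
  fixes c :: "nat \<Rightarrow> complex" and f :: "nat \<Rightarrow> real"
  assumes B: "\<And>N. norm (\<Sum>n=1..N. c n) \<le> B"
    and dec: "\<And>n. n > M \<Longrightarrow> f (Suc n) \<le> f n"
    and nonneg: "\<And>n. n > M \<Longrightarrow> 0 \<le> f n"
  shows "norm (\<Sum>n=Suc M..N. c n * of_real (f n)) \<le> 2 * B * f (Suc M)"
proof -
  have B0: "B \<ge> 0" using B[of 0] by simp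
  show ?thesis
proof (cases "Suc M \<le> N")
  case True
  define D where "D N = (\<Sum>n=Suc M..N. c n)" for N
  have D: "norm (D N) \<le> 2 * B" if "M \<le> N" for N
  proof -
    have "(\<Sum>n=1..N. c n) = (\<Sum>n=1..M. c n) + D N"
      unfolding D_def using that by (rule sum_split_at)
    hence "D N = (\<Sum>n=1..N. c n) - (\<Sum>n=1..M. c n)"
      by simp
    hence "norm (D N) \<le> norm (\<Sum>n=1..N. c n) + norm (\<Sum>n=1..M. c n)"
      by (metis norm_triangle_ineq4)
    with B[of N] B[of M] show ?thesis by linarith
  qed
  \<comment> \<open>The invariant removes the boundary term: what remains is bounded by
    \<open>2 * B\<close> times the decrease of \<open>f\<close> so far, which telescopes.\<close>
  have *: "norm ((\<Sum>n=Suc M..N. c n * of_real (f n)) - D N * of_real (f N))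
             \<le> 2 * B * (f (Suc M) - f N)"
    using True
  proof (induction N rule: dec_induct)
    case base
    show ?case by (simp add: D_def)
  next
    case (step N)
    have "(\<Sum>n=Suc M..Suc N. c n * of_real (f n)) - D (Suc N) * of_real (f (Suc N))
        = ((\<Sum>n=Suc M..N. c n * of_real (f n)) - D N * of_real (f N))
          + D N * of_real (f N - f (Suc N))"
      using step.hyps by (simp add: D_def algebra_simps)
    also have "norm \<dots> \<le> 2 * B * (f (Suc M) - f N) + norm (D N * of_real (f N - f (Suc N)))"
      by (rule norm_triangle_mono[OF step.IH order_refl])
    also have "norm (D N * of_real (f N - f (Suc N))) \<le> 2 * B * (f N - f (Suc N))"
      unfolding norm_mult norm_of_real
      using D[of N] dec[of N] step.hyps B0 by (intro mult_mono) auto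
    finally show ?case by (simp add: algebra_simps)
  qed
  have "norm (\<Sum>n=Suc M..N. c n * of_real (f n))
      \<le> norm ((\<Sum>n=Suc M..N. c n * of_real (f n)) - D N * of_real (f N))
        + norm (D N * of_real (f N))"
    by (metis diff_add_cancel norm_triangle_ineq)
  also have "norm (D N * of_real (f N)) \<le> 2 * B * f N"
    unfolding norm_mult norm_of_real
    using D[of N] nonneg[of N] True B0 by (intro mult_mono) auto
  finally show ?thesis using * by (simp add: algebra_simps)
next
  case False
  with B0 nonneg[of "Suc M"] show ?thesis by simp
qed
qed

lemma dirichlet_test_tail_bound:
  fixes c :: "nat \<Rightarrow> complex" and f :: "nat \<Rightarrow> real"
  assumes B: "\<And>N. norm (\<Sum>n=1..N. c n) \<le> B"
    and dec: "\<And>n. n > 0 \<Longrightarrow> f (Suc n) \<le> f n"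
    and nonneg: "\<And>n. n > 0 \<Longrightarrow> 0 \<le> f n"
    and lim: "f \<longlonglongrightarrow> 0"
  obtains L where "\<And>M. norm ((\<Sum>n=1..M. c n * of_real (f n)) - L) \<le> 2 * B * f (Suc M)"
proof -
  define S where "S N = (\<Sum>n=1..N. c n * of_real (f n))" for N
  have B0: "B \<ge> 0" using B[of 0] by simp
  have diff: "norm (S N - S M) \<le> 2 * B * f (Suc M)" if "M \<le> N" for M N
  proof -
    have "S N = S M + (\<Sum>n=Suc M..N. c n * of_real (f n))"
      unfolding S_def using that by (rule sum_split_at)
    moreover have "norm (\<Sum>n=Suc M..N. c n * of_real (f n)) \<le> 2 * B * f (Suc M)"
      by (rule abel_summation_bound[OF B]) (auto intro: dec nonneg)
    ultimately show ?thesis by (simp only: add_diff_cancel_left')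
  qed
  have lim': "(\<lambda>M. 2 * B * f (Suc M)) \<longlonglongrightarrow> 0"
    using tendsto_mult_right_zero[OF LIMSEQ_Suc[OF lim]] by auto
  have "Cauchy S"
    unfolding Cauchy_altdef2
  proof (intro allI impI)
    fix e :: real assume "e > 0"
    have "\<forall>\<^sub>F M in sequentially. 2 * B * f (Suc M) < e"
      using lim' \<open>e > 0\<close> by (rule order_tendstoD)
    then obtain M where "2 * B * f (Suc M) < e"
      by (auto simp: eventually_sequentially)
    thus "\<exists>N. \<forall>n\<ge>N. dist (S n) (S N) < e"
      using diff by (intro exI[of _ M]) (force simp: dist_norm intro: le_less_trans)
  qed
  then obtain L where L: "S \<longlonglongrightarrow> L"
    by (metis Cauchy_convergent convergent_def)
  have "norm (S M - L) \<le> 2 * B * f (Suc M)" for M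
  proof (rule tendsto_upperbound)
    show "(\<lambda>N. norm (S M - S N)) \<longlonglongrightarrow> norm (S M - L)"
      by (intro tendsto_intros L)
    show "\<forall>\<^sub>F N in sequentially. norm (S M - S N) \<le> 2 * B * f (Suc M)"
      unfolding eventually_sequentially
      by (intro exI[of _ M] allI impI) (subst norm_minus_commute, rule diff)
  qed auto
  thus ?thesis using that unfolding S_def by blast
qed

text \<open>Both sides run over the pairs \<open>(d, k)\<close> with \<open>d * k \<le> N\<close>.
  All Dirichlet convolutions below are rearranged this way.\<close>

lemma sum_divisor_pairs:
  fixes f :: "nat \<Rightarrow> nat \<Rightarrow> 'a :: comm_monoid_add"
  shows "(\<Sum>n=1..N. \<Sum>d | d dvd n. f d (n div d)) = (\<Sum>d=1..N. \<Sum>k=1..N div d. f d k)"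
proof -
  have le: "b \<le> N" if "0 < k" "b * k \<le> N" for b k
  proof -
    have "b \<le> b * k" using that(1) by simp
    with that(2) show ?thesis by (rule order_trans[rotated])
  qed
  have "(\<Sum>n=1..N. \<Sum>d | d dvd n. f d (n div d))
      = (\<Sum>(n,d)\<in>(SIGMA n:{1..N}. {d. d dvd n}). f d (n div d))"
    by (subst sum.Sigma) auto
  also have "\<dots> = (\<Sum>(d,k)\<in>(SIGMA d:{1..N}. {1..N div d}). f d k)"
    by (rule sum.reindex_bij_witness[of _ "\<lambda>(d,k). (d * k, d)" "\<lambda>(n,d). (d, n div d)"])
       (auto simp: less_eq_div_iff_mult_less_eq mult.commute Suc_le_eq elim!: dvdE
             dest: dvd_imp_le intro: le)
  also have "\<dots> = (\<Sum>d=1..N. \<Sum>k=1..N div d. f d k)"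
    by (subst sum.Sigma) auto
  finally show ?thesis .
qed

section \<open>The Moebius function and inversion for \<open>mangoldt\<close>\<close>

definition moebius :: "nat \<Rightarrow> int" where
  "moebius n = (if squarefree n then (-1) ^ card (prime_factors n) else 0)"

lemma abs_moebius_le: "\<bar>moebius n\<bar> \<le> 1"
  by (simp add: moebius_def power_abs)

lemma moebius_1 [simp]: "moebius (Suc 0) = 1"
  by (simp add: moebius_def)

lemma moebius_prime_mult:
  assumes "prime p" "\<not> p dvd d" "d > 0"
  shows "moebius (p * d) = - moebius d"
proof -
  have co: "coprime p d" using assms by (simp add: prime_imp_coprime)
  have "squarefree (p * d) \<longleftrightarrow> squarefree d"
    using co squarefree_prime[OF assms(1)] squarefree_mult_coprime squarefree_mono[of d "p * d"]
    by auto
  moreover have "prime_factors (p * d) = insert p (prime_factors d)"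
    using assms by (subst prime_factors_product) (auto simp: prime_factorization_prime)
  moreover have "p \<notin> prime_factors d" using assms by auto
  ultimately show ?thesis by (simp add: moebius_def)
qed

text \<open>For a prime \<open>p\<close> dividing \<open>n\<close>, the map
  \<open>d \<mapsto> p * d\<close> pairs the squarefree divisors prime to \<open>p\<close> with
  those divisible by \<open>p\<close>, and the paired values cancel.\<close>

lemma sum_moebius_divisors:
  assumes "n > 0"
  shows "(\<Sum>d | d dvd n. moebius d) = (if n = 1 then 1 else 0)"
proof (cases "n = 1")
  case False
  then obtain p where p: "prime p" "p dvd n"
    by (metis prime_factor_nat)
  define A where "A = {d. d dvd n \<and> squarefree d \<and> \<not> p dvd d}"
  define A' where "A' = {d. d dvd n \<and> squarefree d \<and> p dvd d}"
  have fin: "finite A" "finite A'" using assms by (auto simp: A_def A'_def)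
  have pos: "d > 0" if "d \<in> A" for d using that assms by (auto simp: A_def intro!: Nat.gr0I)
  have "(\<Sum>d | d dvd n. moebius d) = (\<Sum>d\<in>A \<union> A'. moebius d)"
    using assms by (intro sum.mono_neutral_right) (auto simp: A_def A'_def moebius_def)
  also have "\<dots> = (\<Sum>d\<in>A. moebius d) + (\<Sum>d\<in>A'. moebius d)"
    using fin by (intro sum.union_disjoint) (auto simp: A_def A'_def)
  also have "(\<Sum>d\<in>A'. moebius d) = (\<Sum>d\<in>A. moebius (p * d))"
  proof (rule sum.reindex_bij_witness[of _ "\<lambda>d. p * d" "\<lambda>d. d div p"])
    fix d assume d: "d \<in> A'"
    then obtain e where e: "d = p * e" by (auto simp: A'_def)
    have "p > 0" using p by (simp add: prime_gt_0_nat)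
    have "\<not> p dvd e"
    proof
      assume "p dvd e"
      hence "p ^ 2 dvd d" using e by (auto simp: power2_eq_square)
      with d p(1) show False by (auto simp: A'_def dest: squarefreeD)
    qed
    moreover have "e dvd d" using e by simp
    hence "squarefree e" "e dvd n"
      using d squarefree_mono[of e d] dvd_trans[of e d n] by (simp_all add: A'_def)
    ultimately show "d div p \<in> A" "p * (d div p) = d" "moebius (p * (d div p)) = moebius d"
      using e \<open>p > 0\<close> by (auto simp: A_def)
  next
    fix d assume d: "d \<in> A"
    have "p > 0" using p by (simp add: prime_gt_0_nat)
    thus "p * d div p = d" by simp
    have co: "coprime p d" using d p by (simp add: A_def prime_imp_coprime)
    thus "p * d \<in> A'"
      using d p by (auto simp: A_def A'_def squarefree_mult_coprime squarefree_prime intro: divides_mult)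
  qed
  also have "\<dots> = (\<Sum>d\<in>A. - moebius d)"
    using p pos by (intro sum.cong refl moebius_prime_mult) (auto simp: A_def)
  finally show ?thesis using False by (simp add: sum_negf)
qed auto

text \<open>Moebius inversion: each \<open>ln (n / d)\<close> is expanded as a divisor sum of
  \<open>mangoldt\<close>, and after swapping the sums only \<open>e = n\<close> survives.\<close>

lemma sum_mangoldt_moebius:
  assumes "n > 0"
  shows "(\<Sum>d | d dvd n. of_int (moebius d) * ln (real (n div d))) = mangoldt n"
proof -
  have "(\<Sum>d | d dvd n. of_int (moebius d) * ln (real (n div d)))
      = (\<Sum>d | d dvd n. \<Sum>e | e dvd n div d. of_int (moebius d) * mangoldt e)"
    using assms
    by (intro sum.cong refl)
       (auto simp: mangoldt_sum[where ?'a = real, simplified] dvd_div_eq_0_iff simp flip: sum_distrib_left)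
  also have "\<dots> = (\<Sum>(d,e)\<in>(SIGMA d:{d. d dvd n}. {e. e dvd n div d}). of_int (moebius d) * mangoldt e)"
    using assms by (subst sum.Sigma) (auto simp: dvd_div_eq_0_iff)
  also have "\<dots> = (\<Sum>(e,d)\<in>(SIGMA e:{e. e dvd n}. {d. d dvd n div e}). of_int (moebius d) * mangoldt e)"
    using assms
    by (intro sum.reindex_bij_witness[of _ "\<lambda>(x,y). (y,x)" "\<lambda>(x,y). (y,x)"])
       (auto simp: dvd_div_iff_mult mult.commute intro: dvd_mult_left dvd_mult_right elim!: dvdE)
  also have "\<dots> = (\<Sum>e | e dvd n. mangoldt e * of_int (\<Sum>d | d dvd n div e. moebius d))"
    using assms by (subst sum.Sigma [symmetric]) (auto simp: dvd_div_eq_0_iff sum_distrib_left mult.commute)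
  also have "\<dots> = (\<Sum>e\<in>{n}. mangoldt e)"
    using assms
    by (intro sum.mono_neutral_cong_right) 
       (auto simp: sum_moebius_divisors dvd_div_eq_0_iff elim!: dvdE simp del: of_int_sum)
  finally show ?thesis by simp
qed

section \<open>Estimates of Chebyshev and Mertens\<close>

lemma ln_fact_le: "ln (fact N) \<le> real N * ln (real N)"
proof (cases "N = 0")
  case False
  have "ln (fact N :: real) \<le> ln (real N ^ N)"
    using False fact_le_power[of N, where ?'a = real]
    by (intro ln_mono) auto
  thus ?thesis using False by (simp add: ln_realpow)
qed auto

lemma ln_Suc_minus_ln_le:
  assumes "n > 0"
  shows "ln (real (Suc n)) - ln (real n) \<le> 1 / real n"
proof -
  have "ln (1 + 1 / real n) \<le> 1 / real n"
    by (rule ln_add_one_self_le_self) auto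
  moreover have "1 + 1 / real n = real (Suc n) / real n"
    using assms by (simp add: field_simps)
  ultimately show ?thesis
    using assms by (simp add: ln_div del: of_nat_Suc)
qed

lemma ln_fact_ge: "ln (fact N) \<ge> real N * ln (real N) - real N"
proof (induction N)
  case (Suc N)
  show ?case
  proof (cases "N = 0")
    case False
    have "real N * (ln (real (Suc N)) - ln (real N)) \<le> real N * (1 / real N)"
      using False by (intro mult_left_mono ln_Suc_minus_ln_le) auto
    hence "real N * ln (real (Suc N)) \<le> real N * ln (real N) + 1"
      using False by (simp add: algebra_simps)
    moreover have "ln (fact (Suc N) :: real) = ln (real (Suc N)) + ln (fact N)"
      unfolding fact_Suc by (subst ln_mult) auto
    ultimately show ?thesis using Suc by (simp add: algebra_simps)
  qed auto
qed auto

lemma ln_fact_conv_sum_ln: "ln (fact N) = (\<Sum>n=1..N. ln (real n))"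
  by (induction N) (simp_all add: ln_mult)

text \<open>Legendre's formula in logarithmic form. It links factorials, whose size is known, to
  sums of \<open>mangoldt\<close>.\<close>

lemma ln_fact_conv_mangoldt:
  "ln (fact N) = (\<Sum>d=1..N. mangoldt d * real (N div d))"
proof -
  have "ln (fact N :: real) = (\<Sum>n=1..N. ln (real n))"
    by (rule ln_fact_conv_sum_ln)
  also have "\<dots> = (\<Sum>n=1..N. \<Sum>d | d dvd n. mangoldt d)"
    by (intro sum.cong refl) (simp add: mangoldt_sum[where ?'a = real, simplified])
  also have "\<dots> = (\<Sum>d=1..N. \<Sum>k=1..N div d. mangoldt d)"
    by (rule sum_divisor_pairs)
  finally show ?thesis by (simp add: mult.commute)
qed

text \<open>With \<open>k = n div 2\<close>, the factorial of \<open>n\<close> is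
  \<open>k! * (n - k)!\<close> times a binomial coefficient of size at most \<open>2 ^ n\<close>,
  and \<open>n - k\<close> is \<open>k\<close> or \<open>k + 1\<close>, which costs at most a factor
  \<open>n\<close>.\<close>

lemma ln_fact_half_le:
  assumes "n > 0"
  shows "ln (fact n) - 2 * ln (fact (n div 2)) \<le> 2 * real n"
proof -
  define k where "k = n div 2"
  have "fact (n - k) \<le> (real n * fact k :: real)"
  proof (cases "even n")
    case True
    hence "n - k = k" by (auto simp: k_def)
    thus ?thesis using assms by simp
  next
    case False
    hence "n - k = Suc k" by (auto simp: k_def elim!: oddE)
    moreover have "Suc k \<le> n" using False by (auto simp: k_def elim!: oddE)
    ultimately show ?thesis by (simp del: of_nat_Suc)
  qed
  moreover have "real (n choose k) \<le> 2 ^ n"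
    using binomial_le_pow2[of n k] by (metis of_nat_le_iff of_nat_numeral of_nat_power)
  moreover have "(fact n :: real) = fact k * fact (n - k) * real (n choose k)"
    using binomial_fact_lemma[of k n]
    by (metis k_def div_le_dividend of_nat_fact of_nat_mult)
  ultimately have "(fact n :: real) \<le> fact k * (real n * fact k) * 2 ^ n"
    by (simp only:) (intro mult_mono, auto)
  hence "ln (fact n :: real) \<le> ln (fact k * (real n * fact k) * 2 ^ n)"
    using assms by (intro ln_mono) auto
  also have "\<dots> = 2 * ln (fact k) + ln (real n) + real n * ln 2"
    using assms by (simp add: ln_mult ln_realpow)
  also have "\<dots> \<le> 2 * ln (fact k) + real n + real n * 1"
    using assms ln_le_minus_one[of "real n"] ln_le_minus_one[of 2]
    by (intro add_mono mult_left_mono) auto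
  finally show ?thesis by (simp add: k_def)
qed

text \<open>Chebyshev's halving argument: \<open>N div d - 2 * (k div d)\<close> is never negative
  and equals 1 for \<open>k < d \<le> N\<close>, so the part of the sum above
  \<open>k = N div 2\<close> is at most \<open>2 * N\<close>. The induction closes with 4 because
  \<open>2 * N + 4 * k \<le> 4 * N\<close>.\<close>

lemma chebyshev_upper: "(\<Sum>n=1..N. mangoldt n) \<le> 4 * real N"
proof (induction N rule: less_induct)
  case (less N)
  show ?case
  proof (cases "N = 0")
    case False
    define k where "k = N div 2"
    have k: "k < N" "2 * k \<le> N" using False by (auto simp: k_def)
    have half: "k div d = (N div d) div 2" for d
      by (simp add: k_def div_mult2_eq [symmetric] mult.commute)
    have le: "2 * (k div d) \<le> N div d" for d
      by (simp add: half)
    have "(\<Sum>n=Suc k..N. mangoldt n :: real) = (\<Sum>d=Suc k..N. mangoldt d * real (N div d - 2 * (k div d)))"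
    proof (intro sum.cong refl)
      fix d assume d: "d \<in> {Suc k..N}"
      have "N div d = 1" using d by (intro div_nat_eqI) (auto simp: k_def)
      thus "mangoldt d = mangoldt d * real (N div d - 2 * (k div d))"
        by (simp add: half)
    qed
    also have "\<dots> \<le> (\<Sum>d=1..N. mangoldt d * real (N div d - 2 * (k div d)))"
      by (intro sum_mono2) (auto intro!: mult_nonneg_nonneg mangoldt_nonneg)
    also have "\<dots> = (\<Sum>d=1..N. mangoldt d * real (N div d)) - 2 * (\<Sum>d=1..N. mangoldt d * real (k div d))"
      using le by (simp add: of_nat_diff sum_subtractf sum_distrib_left algebra_simps)
    also have "(\<Sum>d=1..N. mangoldt d * real (k div d)) = (\<Sum>d=1..k. mangoldt d * real (k div d))"
      using k by (intro sum.mono_neutral_right) auto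
    also have "(\<Sum>d=1..N. mangoldt d * real (N div d)) - 2 * \<dots> \<le> 2 * real N"
      using ln_fact_half_le[of N] False by (simp add: k_def ln_fact_conv_mangoldt)
    finally have "(\<Sum>n=Suc k..N. mangoldt n) \<le> 2 * real N" .
    moreover have "(\<Sum>n=1..k. mangoldt n) \<le> 4 * real k" by (rule less.IH) (fact k)
    ultimately show ?thesis
      using sum_split_at[of k N "mangoldt :: nat \<Rightarrow> real"] k by simp
  qed auto
qed

lemma real_divide_less_div_plus_one:
  assumes "d > 0"
  shows "real N / real d < real (N div d) + 1"
proof -
  have "real N < real (d + d * (N div d))"
    using dividend_less_times_div[OF assms, of N] by (simp only: of_nat_less_iff)
  thus ?thesis using assms by (simp add: field_simps)
qed

text \<open>In Legendre's formula \<open>N div d\<close> is replaced by \<open>N / d\<close>. Each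
  replacement costs at most \<open>mangoldt d\<close>, in total at most \<open>4 * N\<close> by
  Chebyshev's bound; division by \<open>N\<close> leaves the constant 4.\<close>

lemma mertens_mangoldt:
  assumes "N > 0"
  shows "\<bar>(\<Sum>n=1..N. mangoldt n / real n) - ln (real N)\<bar> \<le> 4"
proof -
  define S where "S = (\<Sum>n=1..N. mangoldt n / real n)"
  have "ln (fact N) \<le> (\<Sum>d=1..N. mangoldt d * (real N / real d))"
    unfolding ln_fact_conv_mangoldt
    by (intro sum_mono mult_left_mono mangoldt_nonneg of_nat_div_le_of_nat)
  also have "\<dots> = real N * S" by (simp add: S_def sum_distrib_left field_simps)
  finally have upper: "ln (fact N) \<le> real N * S" .
  have "real N * S - 4 * real N \<le> real N * S - (\<Sum>d=1..N. mangoldt d)"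
    using chebyshev_upper[of N] by simp
  also have "\<dots> = (\<Sum>d=1..N. mangoldt d * (real N / real d - 1))"
    by (simp add: S_def sum_distrib_left sum_subtractf algebra_simps)
  also have "\<dots> \<le> (\<Sum>d=1..N. mangoldt d * real (N div d))"
  proof (intro sum_mono mult_left_mono mangoldt_nonneg)
    fix d assume "d \<in> {1..N}"
    thus "real N / real d - 1 \<le> real (N div d)"
      using real_divide_less_div_plus_one[of d N] by simp
  qed
  also have "\<dots> = ln (fact N)" by (rule ln_fact_conv_mangoldt [symmetric])
  finally have lower: "real N * S - 4 * real N \<le> ln (fact N)" .
  have "real N * ln (real N) - real N \<le> real N * S"
    using upper ln_fact_ge[of N] by linarith
  hence "real N * (ln (real N) - 1) \<le> real N * S" by (simp add: algebra_simps)
  moreover have "real N * (S - 4) \<le> real N * ln (real N)"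
    using lower ln_fact_le[of N] by (simp add: algebra_simps)
  ultimately show ?thesis using assms by (simp add: S_def)
qed

text \<open>Only prime powers \<open>p ^ k\<close> with \<open>k \<ge> 2\<close> contribute; the
  geometric sum over \<open>k\<close> is at most \<open>2 * ln p / p ^ 2\<close>, the term of a
  convergent series. This allows passing from \<open>mangoldt\<close> to primes at bounded
  cost.\<close>

lemma mangoldt_nonprime_sum_bounded:
  "\<exists>C. \<forall>N. (\<Sum>n | n \<in> {1..N} \<and> \<not> prime n. mangoldt n / real n) \<le> C"
proof -
  have summable: "summable (\<lambda>n. 2 * (ln (real n) / real n ^ 2))"
  proof (rule summable_mult, rule summable_comparison_test_bigo)
    show "summable (\<lambda>n. norm (real n powr (-3/2)))"
      by (simp add: summable_real_powr_iff)
    show "(\<lambda>n. ln (real n) / real n ^ 2) \<in> O(\<lambda>n. real n powr (-3/2))"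
      by real_asymp
  qed
  have "(\<Sum>n | n \<in> {1..N} \<and> \<not> prime n. mangoldt n / real n) \<le> (\<Sum>n. 2 * (ln (real n) / real n ^ 2))" for N
  proof -
    define P where "P = {p\<in>{1..N}. prime p}"
    define g where "g = (\<lambda>(p,k). p ^ k :: nat)"
    have "(\<Sum>n | n \<in> {1..N} \<and> \<not> prime n. mangoldt n / real n :: real)
        = (\<Sum>n | n \<in> {1..N} \<and> primepow n \<and> \<not> prime n. mangoldt n / real n)"
      by (intro sum.mono_neutral_right) (auto simp: mangoldt_def)
    also have "\<dots> \<le> (\<Sum>n\<in>g ` (P \<times> {2..N}). mangoldt n / real n)"
    proof (intro sum_mono2)
      show "{n. n \<in> {1..N} \<and> primepow n \<and> \<not> prime n} \<subseteq> g ` (P \<times> {2..N})"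
      proof
        fix n assume n: "n \<in> {n. n \<in> {1..N} \<and> primepow n \<and> \<not> prime n}"
        then obtain p k where pk: "prime p" "k > 0" "n = p ^ k"
          by (auto simp: primepow_def)
        have "k \<noteq> 1" using n pk by auto
        with pk have k: "k \<ge> 2" by simp
        \<comment> \<open>Both \<open>p\<close> and \<open>k\<close> are at most
          \<open>p ^ k \<le> N\<close>, so the crude box \<open>P \<times> {2..N}\<close> catches
          every such prime power.\<close>
        have "p ^ 1 \<le> p ^ k" by (intro power_increasing) (use pk prime_gt_0_nat[OF pk(1)] in auto)
        moreover have "k < p ^ k" using prime_gt_1_nat[OF pk(1)] by (intro power_gt_expt) auto
        ultimately have "(p, k) \<in> P \<times> {2..N}"
          using pk n k prime_gt_0_nat[OF pk(1)] by (auto simp: P_def)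
        thus "n \<in> g ` (P \<times> {2..N})" using pk by (force simp: g_def)
      qed
    qed (auto simp: P_def mangoldt_nonneg)
    also have "\<dots> \<le> (\<Sum>x\<in>P \<times> {2..N}. mangoldt (g x) / real (g x))"
      by (rule sum_image_le[unfolded comp_def]) (auto simp: P_def mangoldt_nonneg)
    also have "\<dots> = (\<Sum>p\<in>P. \<Sum>k=2..N. ln (real p) * (1 / real p) ^ k)"
      unfolding sum.cartesian_product
      by (auto simp: g_def P_def power_divide intro!: sum.cong)
    also have "\<dots> \<le> (\<Sum>p\<in>P. 2 * (ln (real p) / real p ^ 2))"
    proof (intro sum_mono)
      fix p assume "p \<in> P"
      hence p: "p \<ge> 2" by (auto simp: P_def prime_ge_2_nat)
      define x where "x = 1 / real p"
      have x: "0 < x" "x \<le> 1 / 2" using p by (auto simp: x_def field_simps)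
      have "(\<Sum>k=2..N. x ^ k) \<le> 2 * x ^ 2"
      proof (cases "2 \<le> N")
        case True
        have "(\<Sum>k=2..N. x ^ k) = (x ^ 2 - x ^ Suc N) / (1 - x)"
          using True x by (subst sum_gp) auto
        also have "\<dots> \<le> x ^ 2 / (1 / 2)"
          using x by (intro frac_le) auto
        finally show ?thesis by simp
      qed auto
      hence "ln (real p) * (\<Sum>k=2..N. x ^ k) \<le> ln (real p) * (2 * x ^ 2)"
        using p by (intro mult_left_mono) auto
      thus "(\<Sum>k=2..N. ln (real p) * (1 / real p) ^ k) \<le> 2 * (ln (real p) / real p ^ 2)"
        by (simp add: x_def sum_distrib_left power_divide mult.commute)
    qed
    also have "\<dots> \<le> (\<Sum>p<Suc N. 2 * (ln (real p) / real p ^ 2))"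
    proof (intro sum_mono2)
      show "0 \<le> 2 * (ln (real p) / real p ^ 2)" for p
        by (cases "p = 0") auto
    qed (auto simp: P_def)
    also have "\<dots> \<le> (\<Sum>n. 2 * (ln (real n) / real n ^ 2))"
    proof (intro sum_le_suminf summable)
      show "0 \<le> 2 * (ln (real p) / real p ^ 2)" for p
        by (cases "p = 0") auto
    qed auto
    finally show ?thesis .
  qed
  thus ?thesis by blast
qed

section \<open>Dirichlet characters\<close>

text \<open>A character of the unit group modulo \<open>m\<close>, extended periodically and by 0.
  As plain functions on the naturals, characters can be compared by extensionality and summed over
  as a set. The value 1 at 1 follows, since it is a nonzero idempotent.\<close>

definition dchar :: "nat \<Rightarrow> (nat \<Rightarrow> complex) \<Rightarrow> bool" where
  "dchar m \<phi> \<longleftrightarrow> (\<forall>a b. \<phi> (a * b) = \<phi> a * \<phi> b) \<and> (\<forall>a. \<phi> (a mod m) = \<phi> a) \<and>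
     (\<forall>a. \<phi> a = 0 \<longleftrightarrow> \<not> coprime a m)"

definition principal_dchar :: "nat \<Rightarrow> nat \<Rightarrow> complex" where
  "principal_dchar m a = (if coprime a m then 1 else 0)"

lemma dchar_mult: "dchar m \<phi> \<Longrightarrow> \<phi> (a * b) = \<phi> a * \<phi> b"
  and dchar_mod: "dchar m \<phi> \<Longrightarrow> \<phi> (a mod m) = \<phi> a"
  and dchar_eq_0_iff: "dchar m \<phi> \<Longrightarrow> \<phi> a = 0 \<longleftrightarrow> \<not> coprime a m"
  by (simp_all add: dchar_def)

lemma dchar_cong: "dchar m \<phi> \<Longrightarrow> [a = b] (mod m) \<Longrightarrow> \<phi> a = \<phi> b"
  by (metis cong_def dchar_mod)

lemma dchar_1: "dchar m \<phi> \<Longrightarrow> \<phi> (Suc 0) = 1"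
  using dchar_mult[of m \<phi> "Suc 0" "Suc 0"] dchar_eq_0_iff[of m \<phi> "Suc 0"] by simp

lemma dchar_power: "dchar m \<phi> \<Longrightarrow> \<phi> (a ^ k) = \<phi> a ^ k"
  by (induction k) (simp_all add: dchar_1 dchar_mult)

lemma dchar_principal: "m > 0 \<Longrightarrow> dchar m (principal_dchar m)"
  by (auto simp: dchar_def principal_dchar_def)

lemma dchar_eqI:
  assumes "dchar m \<phi>" "dchar m \<psi>" "\<And>a. coprime a m \<Longrightarrow> \<phi> a = \<psi> a"
  shows "\<phi> = \<psi>"
  using assms dchar_eq_0_iff by (metis ext)

lemma dchar_times: "dchar m \<phi> \<Longrightarrow> dchar m \<psi> \<Longrightarrow> dchar m (\<lambda>a. \<phi> a * \<psi> a)"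
  by (auto simp: dchar_def)

lemma dchar_cnj: "dchar m \<phi> \<Longrightarrow> dchar m (\<lambda>a. cnj (\<phi> a))"
  by (auto simp: dchar_def)

lemma dchar_power_totient:
  assumes "dchar m \<phi>" "coprime a m"
  shows "\<phi> a ^ totient m = 1"
  using dchar_power[OF assms(1)] dchar_cong[OF assms(1) euler_theorem[OF assms(2)]] dchar_1[OF assms(1)]
  by (metis One_nat_def)

lemma norm_dchar:
  assumes "dchar m \<phi>" "coprime a m" "m > 0"
  shows "norm (\<phi> a) = 1"
proof -
  have "norm (\<phi> a) ^ totient m = 1"
    using dchar_power_totient[OF assms(1,2)] by (metis norm_one norm_power)
  thus ?thesis using assms(3) power_eq_imp_eq_base[of "norm (\<phi> a)" "totient m" 1] by simp
qed

lemma norm_dchar_le: "dchar m \<phi> \<Longrightarrow> m > 0 \<Longrightarrow> norm (\<phi> a) \<le> 1"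
  by (cases "coprime a m") (auto simp: norm_dchar dchar_eq_0_iff[THEN iffD2])

text \<open>By periodicity a character is determined on \<open>{..<m}\<close>, and by Euler's
  theorem its values are 0 or roots of unity of order dividing \<open>totient m\<close>.\<close>

lemma finite_dchars:
  assumes "m > 0"
  shows "finite {\<phi>. dchar m \<phi>}"
proof (rule finite_imageD)
  let ?r = "\<lambda>\<phi>. restrict \<phi> {..<m}"
  let ?R = "insert 0 {z::complex. z ^ totient m = 1}"
  have "?r ` {\<phi>. dchar m \<phi>} \<subseteq> {..<m} \<rightarrow>\<^sub>E ?R"
  proof (intro image_subsetI PiE_I)
    fix \<phi> a assume *: "\<phi> \<in> {\<phi>. dchar m \<phi>}" "a \<in> {..<m}"
    thus "restrict \<phi> {..<m} a \<in> ?R"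
      using dchar_power_totient[of m \<phi> a] dchar_eq_0_iff[of m \<phi> a] by auto
  qed auto
  moreover have "finite ({..<m} \<rightarrow>\<^sub>E ?R)"
    using assms by (intro finite_PiE) (auto intro!: finite_roots_unity simp: Suc_le_eq)
  ultimately show "finite (?r ` {\<phi>. dchar m \<phi>})" by (rule finite_subset)
  show "inj_on ?r {\<phi>. dchar m \<phi>}"
  proof (rule inj_onI)
    fix \<phi> \<psi> assume *: "\<phi> \<in> {\<phi>. dchar m \<phi>}" "\<psi> \<in> {\<phi>. dchar m \<phi>}" "?r \<phi> = ?r \<psi>"
    show "\<phi> = \<psi>"
    proof
      fix a
      have "\<phi> (a mod m) = \<psi> (a mod m)"
        using fun_cong[OF *(3), of "a mod m"] assms by simp
      thus "\<phi> a = \<psi> a" using * by (simp add: dchar_mod)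
    qed
  qed
qed

text \<open>Multiplication by a unit \<open>a\<close> with \<open>\<phi> a \<noteq> 1\<close>
  permutes the residues, so the sum over a full period vanishes and fewer than \<open>m\<close>
  terms remain.\<close>

lemma norm_sum_nonprincipal_dchar_le:
  assumes \<phi>: "dchar m \<phi>" and m: "m > 0" and np: "\<phi> \<noteq> principal_dchar m"
  shows "norm (\<Sum>n=1..N. \<phi> n) \<le> real (m + 1)"
proof -
  obtain a where a: "coprime a m" "\<phi> a \<noteq> 1"
    using np dchar_eqI[OF \<phi> dchar_principal[OF m]] by (auto simp: principal_dchar_def)
  have inj: "inj_on (\<lambda>n. a * n mod m) {..<m}"
  proof (rule inj_onI)
    fix x y assume xy: "x \<in> {..<m}" "y \<in> {..<m}" "a * x mod m = a * y mod m"
    hence "[x = y] (mod m)"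
      using cong_mult_lcancel_nat[OF a(1)] by (simp add: cong_def)
    thus "x = y" using xy by (simp add: cong_def)
  qed
  have "\<phi> a * (\<Sum>n<m. \<phi> n) = (\<Sum>n<m. \<phi> (a * n mod m))"
    by (simp add: sum_distrib_left dchar_mod[OF \<phi>] dchar_mult[OF \<phi>])
  also have "\<dots> = (\<Sum>n\<in>(\<lambda>n. a * n mod m) ` {..<m}. \<phi> n)"
    by (subst sum.reindex[OF inj]) simp
  also have "(\<lambda>n. a * n mod m) ` {..<m} = {..<m}"
    by (rule endo_inj_surj) (use inj m in auto)
  finally have zero: "(\<Sum>n<m. \<phi> n) = 0" using a(2) by (metis mult_cancel_right1)
  have shift: "(\<Sum>n<m + k. \<phi> n) = (\<Sum>n<m. \<phi> n) + (\<Sum>n<k. \<phi> (n + m))" for k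
    by (induction k) (simp_all add: add_ac)
  have le: "norm (\<Sum>n<N. \<phi> n) \<le> real m" for N
  proof (induction N rule: less_induct)
    case (less N)
    show ?case
    proof (cases "N < m")
      case True
      have "norm (\<Sum>n<N. \<phi> n) \<le> (\<Sum>n<N. 1)"
        by (intro sum_norm_le norm_dchar_le[OF \<phi> m])
      thus ?thesis using True by simp
    next
      case False
      have "(\<Sum>n<N. \<phi> n) = (\<Sum>n<m. \<phi> n) + (\<Sum>n<N - m. \<phi> (n + m))"
        using shift[of "N - m"] False by simp
      also have "(\<Sum>n<N - m. \<phi> (n + m)) = (\<Sum>n<N - m. \<phi> n)"
        by (intro sum.cong refl dchar_cong[OF \<phi>]) (simp add: cong_def)
      finally show ?thesis using zero less.IH[of "N - m"] False m by simp
    qed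
  qed
  \<comment> \<open>Periods are counted from 0 but the sums start at 1; the value
    \<open>\<phi> 0\<close> accounts for the extra 1 in the bound.\<close>
  have "(\<Sum>n<Suc N. \<phi> n) = \<phi> 0 + (\<Sum>n=1..N. \<phi> n)"
    by (induction N) simp_all
  hence "norm (\<Sum>n=1..N. \<phi> n) = norm ((\<Sum>n<Suc N. \<phi> n) - \<phi> 0)" by simp
  also have "\<dots> \<le> real m + 1"
    by (intro order_trans[OF norm_triangle_ineq4] add_mono le norm_dchar_le[OF \<phi> m])
  finally show ?thesis by simp
qed

text \<open>Some prime power \<open>q\<close> in the factorization of \<open>m\<close> already
  distinguishes \<open>n\<close> from 1. As \<open>q\<close> is odd it has a primitive root, and the
  discrete logarithm followed by an exponential is a faithful character of the units modulo
  \<open>q\<close>, which is then lifted to \<open>m\<close>.\<close>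

lemma dchar_separating:
  assumes "odd m" "coprime n m" "\<not> [n = 1] (mod m)"
  obtains \<phi> where "dchar m \<phi>" "\<phi> n \<noteq> 1"
proof -
  have m: "m > 0" using assms(1) by (auto intro!: Nat.gr0I)
  have "(\<Prod>p\<in>prime_factors m. p ^ multiplicity p m) = m"
    using prod_prime_factors[of m] m by simp
  hence "\<exists>p\<in>prime_factors m. \<not> [n = 1] (mod p ^ multiplicity p m)"
    using assms(3) coprime_cong_prod_nat[of "prime_factors m" "\<lambda>p. p ^ multiplicity p m" n 1]
    by (metis coprime_power_left_iff coprime_power_right_iff in_prime_factors_iff primes_coprime)
  then obtain p where p: "p \<in> prime_factors m" "\<not> [n = 1] (mod p ^ multiplicity p m)" by blast
  define q where "q = p ^ multiplicity p m"
  have prime: "prime p" and "p dvd m" using p by auto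
  have "odd p" using \<open>p dvd m\<close> assms(1) by auto
  have k: "multiplicity p m > 0" using p by (simp add: prime_factors_multiplicity)
  have "q dvd m" unfolding q_def by (rule multiplicity_dvd)
  have "q > 1" unfolding q_def using k prime_gt_1_nat[OF prime] by (intro one_less_power) auto
  obtain g where g: "residue_primroot q g"
    using residue_primroot_odd_prime_power_exists[OF prime \<open>odd p\<close>] k unfolding q_def by blast
  define N where "N = totient q"
  have N: "N \<ge> 1" using \<open>q > 1\<close> by (simp add: N_def Suc_le_eq)
  have ord: "ord q g = N" and cog: "coprime q g" using g by (auto simp: residue_primroot_def N_def)
  \<comment> \<open>The choice fixes the discrete logarithm only modulo
    \<open>N = totient q\<close>, which is all that \<open>e\<close> depends on.\<close>
  define ind where "ind a = (SOME i. [g ^ i = a] (mod q))" for a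
  have ind: "[g ^ ind a = a] (mod q)" if "coprime a m" for a
  proof -
    have "coprime a q" using that \<open>q dvd m\<close> by (metis coprime_divisors dvd_refl)
    hence "a mod q \<in> totatives q"
      using \<open>q > 1\<close> by (auto simp: totatives_def coprime_commute intro!: Nat.gr0I)
    hence "a mod q \<in> (\<lambda>i. g ^ i mod q) ` {..<totient q}"
      using residue_primroot_is_generator[OF \<open>q > 1\<close> g] by (simp add: bij_betw_def)
    then obtain i where "g ^ i mod q = a mod q" by (elim imageE) simp
    hence "[g ^ i = a] (mod q)" by (simp add: cong_def)
    thus ?thesis unfolding ind_def by (rule someI)
  qed
  have expeq: "[i = j] (mod N)" if "[g ^ i = g ^ j] (mod q)" for i j
    using order_divides_expdiff[OF cog] that ord by simp
  define e where "e i = exp (2 * of_real pi * \<i> * of_nat i / of_nat N)" for i :: nat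
  have e_add: "e (i + j) = e i * e j" for i j
    by (simp add: e_def exp_add [symmetric] add_divide_distrib ring_distribs)
  have e_eq: "e i = e j" if "[i = j] (mod N)" for i j
    using complex_root_unity_eq[OF N, of i j] that by (simp add: e_def cong_def)
  define \<phi> where "\<phi> a = (if coprime a m then e (ind a) else 0)" for a
  have e_cong: "e (ind a) = e (ind b)" if "[a = b] (mod m)" "coprime a m" for a b
  proof -
    have "coprime b m" using that cong_imp_coprime by blast
    have "[a = b] (mod q)" using that(1) \<open>q dvd m\<close> by (rule cong_dvd_modulus_nat)
    with ind[OF that(2)] ind[OF \<open>coprime b m\<close>] have "[g ^ ind a = g ^ ind b] (mod q)"
      by (metis cong_sym cong_trans)
    thus ?thesis by (intro e_eq expeq)
  qed
  have "dchar m \<phi>"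
    unfolding dchar_def
  proof (intro conjI allI)
    fix a b
    show "\<phi> (a * b) = \<phi> a * \<phi> b"
    proof (cases "coprime a m \<and> coprime b m")
      case True
      hence co: "coprime (a * b) m" by simp
      have "[g ^ ind a * g ^ ind b = a * b] (mod q)"
        using True ind by (intro cong_mult) auto
      hence "[g ^ ind (a * b) = g ^ (ind a + ind b)] (mod q)"
        using ind[OF co] by (metis cong_sym cong_trans power_add)
      hence "e (ind (a * b)) = e (ind a + ind b)" by (intro e_eq expeq)
      thus ?thesis using True co by (simp add: \<phi>_def e_add)
    qed (auto simp: \<phi>_def)
    show "\<phi> (a mod m) = \<phi> a"
      using e_cong[of "a mod m" a] m by (simp add: \<phi>_def)
    show "\<phi> a = 0 \<longleftrightarrow> \<not> coprime a m" by (simp add: \<phi>_def e_def)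
  qed
  moreover have "\<phi> n \<noteq> 1"
  proof
    assume "\<phi> n = 1"
    hence "e (ind n) = 1" using assms(2) by (simp add: \<phi>_def)
    hence "N dvd ind n" using complex_root_unity_eq_1[OF N] by (simp add: e_def)
    hence "[g ^ ind n = 1] (mod q)" using ord ord_divides[of g "ind n" q] by simp
    hence "[n = 1] (mod q)" using ind[OF assms(2)] by (metis cong_sym cong_trans)
    thus False using p(2) by (simp add: q_def)
  qed
  ultimately show ?thesis by (rule that)
qed

text \<open>Multiplying by a character \<open>\<psi>\<close> permutes the characters, so the sum is
  unchanged by the factor \<open>\<psi> n\<close>; a separating \<open>\<psi>\<close> has
  \<open>\<psi> n \<noteq> 1\<close> and forces it to be 0.\<close>

lemma sum_dchars:
  assumes "odd m"
  shows "(\<Sum>\<phi> | dchar m \<phi>. \<phi> n) = (if [n = 1] (mod m) then of_nat (card {\<phi>. dchar m \<phi>}) else 0)"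
proof (cases "[n = 1] (mod m)")
  case True
  hence "\<phi> n = 1" if "dchar m \<phi>" for \<phi>
    using dchar_cong[OF that] dchar_1[OF that] by (metis One_nat_def)
  hence "(\<Sum>\<phi> | dchar m \<phi>. \<phi> n) = (\<Sum>\<phi> | dchar m \<phi>. 1)"
    by (intro sum.cong refl) simp
  thus ?thesis using True by simp
next
  case False
  have m: "m > 0" using assms(1) by (auto intro!: Nat.gr0I)
  show ?thesis
  proof (cases "coprime n m")
    case True
    then obtain \<psi> where \<psi>: "dchar m \<psi>" "\<psi> n \<noteq> 1"
      using dchar_separating assms False by blast
    let ?X = "{\<phi>. dchar m \<phi>}"
    have inj: "inj_on (\<lambda>\<phi> a. \<psi> a * \<phi> a) ?X"
    proof (rule inj_onI)
      fix \<phi>1 \<phi>2 assume *: "\<phi>1 \<in> ?X" "\<phi>2 \<in> ?X" "(\<lambda>a. \<psi> a * \<phi>1 a) = (\<lambda>a. \<psi> a * \<phi>2 a)"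
      show "\<phi>1 = \<phi>2"
      proof (rule dchar_eqI)
        fix a assume "coprime a m"
        hence "\<psi> a \<noteq> 0" by (simp add: dchar_eq_0_iff[OF \<psi>(1)])
        thus "\<phi>1 a = \<phi>2 a" using fun_cong[OF *(3), of a] by simp
      qed (use * in auto)
    qed
    have "\<psi> n * (\<Sum>\<phi>\<in>?X. \<phi> n) = (\<Sum>\<phi>\<in>(\<lambda>\<phi> a. \<psi> a * \<phi> a) ` ?X. \<phi> n)"
      by (subst sum.reindex[OF inj]) (simp add: sum_distrib_left)
    also have "(\<lambda>\<phi> a. \<psi> a * \<phi> a) ` ?X = ?X"
      by (rule endo_inj_surj) (use inj finite_dchars[OF m] \<psi>(1) in \<open>auto intro: dchar_times\<close>)
    finally have "(\<Sum>\<phi>\<in>?X. \<phi> n) = 0" using \<psi>(2) by (metis mult_cancel_right1)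
    thus ?thesis using False by simp
  next
    case False
    hence "\<phi> n = 0" if "dchar m \<phi>" for \<phi>
      using dchar_eq_0_iff[OF that] by simp
    hence "(\<Sum>\<phi> | dchar m \<phi>. \<phi> n) = 0" by (intro sum.neutral) simp
    thus ?thesis using \<open>\<not> [n = 1] (mod m)\<close> by simp
  qed
qed

section \<open>Character sums over prime powers\<close>

text \<open>The value \<open>L(1, \<phi>)\<close>. The series converges only conditionally, hence a
  limit of partial sums in their natural order; it is meaningful for nonprincipal
  \<open>\<phi>\<close>.\<close>

definition dirichlet_L1 :: "(nat \<Rightarrow> complex) \<Rightarrow> complex" where
  "dirichlet_L1 \<phi> = lim (\<lambda>N. \<Sum>n=1..N. \<phi> n / of_nat n)"

lemma dirichlet_L1_tail:
  assumes "dchar m \<phi>" "m > 0" "\<phi> \<noteq> principal_dchar m"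
  shows "norm ((\<Sum>n=1..N. \<phi> n / of_nat n) - dirichlet_L1 \<phi>) \<le> 2 * real (m + 1) / real (Suc N)"
    and "(\<lambda>N. \<Sum>n=1..N. \<phi> n / of_nat n) \<longlonglongrightarrow> dirichlet_L1 \<phi>"
proof -
  let ?S = "\<lambda>N. \<Sum>n=1..N. \<phi> n / of_nat n"
  obtain L where L: "\<And>M. norm ((\<Sum>n=1..M. \<phi> n * of_real (1 / real n)) - L) \<le> 2 * real (m + 1) * (1 / real (Suc M))"
  proof (rule dirichlet_test_tail_bound[where f = "\<lambda>n. 1 / real n"])
    show "norm (\<Sum>n=1..N. \<phi> n) \<le> real (m + 1)" for N
      by (rule norm_sum_nonprincipal_dchar_le[OF assms])
    show "(\<lambda>n. 1 / real n) \<longlonglongrightarrow> 0" by (rule lim_1_over_n)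
  qed (auto simp: field_simps)
  have L': "norm (?S M - L) \<le> 2 * real (m + 1) / real (Suc M)" for M
    using L[of M] by simp
  have "(\<lambda>M. ?S M - L) \<longlonglongrightarrow> 0"
  proof (rule tendsto_norm_zero_cancel, rule tendsto_sandwich[OF _ _ tendsto_const])
    show "(\<lambda>M. 2 * real (m + 1) / real (Suc M)) \<longlonglongrightarrow> 0"
      by real_asymp
  qed (use L' in auto)
  hence "?S \<longlonglongrightarrow> L" by (rule LIM_zero_cancel)
  moreover from this have "dirichlet_L1 \<phi> = L"
    unfolding dirichlet_L1_def by (rule limI)
  ultimately show "norm (?S N - dirichlet_L1 \<phi>) \<le> 2 * real (m + 1) / real (Suc N)"
    "?S \<longlonglongrightarrow> dirichlet_L1 \<phi>" using L' by simp_all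
qed

lemma dirichlet_L1_cnj:
  assumes "dchar m \<phi>" "m > 0" "\<phi> \<noteq> principal_dchar m"
  shows "dirichlet_L1 (\<lambda>a. cnj (\<phi> a)) = cnj (dirichlet_L1 \<phi>)"
  unfolding dirichlet_L1_def[of "\<lambda>a. cnj (\<phi> a)"]
  using tendsto_cnj[OF dirichlet_L1_tail(2)[OF assms]] by (intro limI) simp

text \<open>A bound linear in \<open>d\<close> is what is needed: it cancels the weight
  \<open>1 / d\<close> when summed over \<open>d\<close>.\<close>

lemma norm_dirichlet_L1_tail_div:
  assumes "dchar m \<phi>" "m > 0" "\<phi> \<noteq> principal_dchar m" "d > 0" "N > 0"
  shows "norm ((\<Sum>n=1..N div d. \<phi> n / of_nat n) - dirichlet_L1 \<phi>) \<le> 2 * real (m + 1) * (real d / real N)"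
proof -
  have "real N / real d \<le> real (Suc (N div d))"
    using real_divide_less_div_plus_one[of d N] assms by simp
  hence "1 / real (Suc (N div d)) \<le> 1 / (real N / real d)"
    using assms by (intro divide_left_mono) (auto simp del: of_nat_Suc)
  hence "2 * real (m + 1) * (1 / real (Suc (N div d))) \<le> 2 * real (m + 1) * (real d / real N)"
    using assms by (intro mult_left_mono) (auto simp del: of_nat_Suc)
  with dirichlet_L1_tail(1)[OF assms(1-3), of "N div d"] show ?thesis
    by simp
qed

lemma ln_over_id_decreasing:
  assumes "n \<ge> 3"
  shows "ln (real (Suc n)) / real (Suc n) \<le> ln (real n) / real n"
proof -
  have "exp 1 \<le> real n" using assms exp_le by linarith
  hence "1 \<le> ln (real n)" using assms by (subst ln_ge_iff) auto
  have "real n * (ln (real (Suc n)) - ln (real n)) \<le> real n * (1 / real n)"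
    using assms by (intro mult_left_mono ln_Suc_minus_ln_le) auto
  hence "real n * ln (real (Suc n)) \<le> real n * ln (real n) + 1"
    using assms by (simp add: algebra_simps)
  also have "\<dots> \<le> real (Suc n) * ln (real n)"
    using \<open>1 \<le> ln (real n)\<close> by (simp add: algebra_simps)
  finally show ?thesis using assms by (simp add: divide_simps mult_ac del: of_nat_Suc)
qed

text \<open>Since \<open>ln n / n\<close> is decreasing only from 3 on, the first three terms are
  bounded trivially and summation by parts handles the rest.\<close>

lemma norm_sum_nonprincipal_dchar_ln_bounded:
  assumes "dchar m \<phi>" "m > 0" "\<phi> \<noteq> principal_dchar m"
  shows "\<exists>C. \<forall>N. norm (\<Sum>n=1..N. \<phi> n * of_real (ln (real n) / real n)) \<le> C"
proof (intro exI allI)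
  fix N
  let ?f = "\<lambda>n. ln (real n) / real n"
  define B where "B = real (m + 1)"
  have tail: "norm (\<Sum>n=Suc 3..N. \<phi> n * of_real (?f n)) \<le> 2 * B * ?f (Suc 3)"
    unfolding B_def
    by (rule abel_summation_bound[OF norm_sum_nonprincipal_dchar_le[OF assms]])
       (auto intro!: ln_over_id_decreasing simp del: of_nat_Suc)
  have head: "norm (\<Sum>n=1..M. \<phi> n * of_real (?f n)) \<le> (\<Sum>n=1..3. ?f n)" if "M \<le> 3" for M
  proof -
    have "norm (\<Sum>n=1..M. \<phi> n * of_real (?f n)) \<le> (\<Sum>n=1..M. 1 * ?f n)"
      unfolding norm_mult norm_of_real
      by (intro sum_norm_le, unfold norm_mult norm_of_real, intro mult_mono norm_dchar_le[OF assms(1,2)]) auto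
    also have "\<dots> \<le> (\<Sum>n=1..3. 1 * ?f n)"
      using that by (intro sum_mono2) auto
    finally show ?thesis by simp
  qed
  show "norm (\<Sum>n=1..N. \<phi> n * of_real (?f n)) \<le> (\<Sum>n=1..3. ?f n) + 2 * B * ?f (Suc 3)"
  proof (cases "N \<le> 3")
    case True
    have "0 \<le> 2 * B * ?f (Suc 3)" by (simp add: B_def)
    with head[OF True] show ?thesis by linarith
  next
    case False
    have "(\<Sum>n=1..N. \<phi> n * of_real (?f n))
        = (\<Sum>n=1..3. \<phi> n * of_real (?f n)) + (\<Sum>n=Suc 3..N. \<phi> n * of_real (?f n))"
      using False by (intro sum_split_at) auto
    thus ?thesis using norm_triangle_mono[OF head[of 3] tail] by simp
  qed
qed

text \<open>The common error term of the cases \<open>L(1) \<noteq> 0\<close> and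
  \<open>L(1) = 0\<close>: after the cancellation of \<open>d\<close> only the mean of
  \<open>v\<close> remains. It is used with \<open>v = mangoldt\<close>, \<open>V = 4\<close> and
  with \<open>v d = ln (N / d)\<close>, \<open>V = 1\<close>.\<close>

lemma norm_sum_mult_L1_tail_le:
  assumes "dchar m \<phi>" "m > 0" "\<phi> \<noteq> principal_dchar m"
    and w: "\<And>d. d \<in> {1..N} \<Longrightarrow> norm (w d) \<le> v d / real d"
    and V: "(\<Sum>d=1..N. v d) \<le> V * real N" and "V \<ge> 0"
  shows "norm (\<Sum>d=1..N. w d * ((\<Sum>k=1..N div d. \<phi> k / of_nat k) - dirichlet_L1 \<phi>)) \<le> 2 * real (m + 1) * V"
proof (cases "N = 0")
  case False
  have "norm (\<Sum>d=1..N. w d * ((\<Sum>k=1..N div d. \<phi> k / of_nat k) - dirichlet_L1 \<phi>))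
      \<le> (\<Sum>d=1..N. v d / real d * (2 * real (m + 1) * (real d / real N)))"
  proof (intro sum_norm_le)
    fix d assume d: "d \<in> {1..N}"
    show "norm (w d * ((\<Sum>k=1..N div d. \<phi> k / of_nat k) - dirichlet_L1 \<phi>))
        \<le> v d / real d * (2 * real (m + 1) * (real d / real N))"
      unfolding norm_mult
      using d False order_trans[OF norm_ge_zero w[OF d]]
      by (intro mult_mono w norm_dirichlet_L1_tail_div[OF assms(1-3)]) auto
  qed
  also have "\<dots> = (\<Sum>d=1..N. 2 * real (m + 1) / real N * v d)"
    by (intro sum.cong refl) (auto simp: field_simps)
  also have "\<dots> = 2 * real (m + 1) / real N * (\<Sum>d=1..N. v d)"
    by (rule sum_distrib_left [symmetric])
  also have "\<dots> \<le> 2 * real (m + 1) / real N * (V * real N)"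
    by (intro mult_left_mono V) auto
  also have "\<dots> = 2 * real (m + 1) * V" using False by simp
  finally show ?thesis .
qed (use assms in auto)

text \<open>The identity expressing \<open>ln\<close> as a divisor sum of \<open>mangoldt\<close>,
  twisted by \<open>\<phi> n / n\<close>, gives a bounded left side and a right side where each
  inner sum is nearly \<open>L(1)\<close>. So \<open>L(1)\<close> times the wanted sum is bounded,
  and \<open>L(1)\<close> can be divided out.\<close>

lemma sum_dchar_mangoldt_bounded:
  assumes "dchar m \<phi>" "m > 0" "\<phi> \<noteq> principal_dchar m" "dirichlet_L1 \<phi> \<noteq> 0"
  shows "\<exists>C. \<forall>N. norm (\<Sum>n=1..N. \<phi> n * of_real (mangoldt n / real n)) \<le> C"
proof -
  let ?S = "\<lambda>M. \<Sum>k=1..M. \<phi> k / of_nat k"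
  define L where "L = dirichlet_L1 \<phi>"
  obtain C where C: "\<And>N. norm (\<Sum>n=1..N. \<phi> n * of_real (ln (real n) / real n)) \<le> C"
    using norm_sum_nonprincipal_dchar_ln_bounded[OF assms(1-3)] by blast
  have "norm (\<Sum>n=1..N. \<phi> n * of_real (mangoldt n / real n)) \<le> (C + 2 * real (m + 1) * 4) / norm L" for N
  proof -
    define w where "w d = \<phi> d * of_real (mangoldt d / real d)" for d
    have "(\<Sum>n=1..N. \<phi> n * of_real (ln (real n) / real n))
        = (\<Sum>n=1..N. \<Sum>d | d dvd n. w d * (\<phi> (n div d) / of_nat (n div d)))"
    proof (intro sum.cong refl)
      fix n assume n: "n \<in> {1..N}"
      have "\<phi> n * of_real (ln (real n) / real n) = (\<Sum>d | d dvd n. \<phi> n / of_nat n * of_real (mangoldt d))"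
        using n mangoldt_sum[of n, where ?'a = complex] by (simp flip: sum_distrib_left sum_divide_distrib)
      also have "\<dots> = (\<Sum>d | d dvd n. w d * (\<phi> (n div d) / of_nat (n div d)))"
      proof (intro sum.cong refl)
        fix d assume "d \<in> {d. d dvd n}"
        then obtain k where k: "n = d * k" by auto
        thus "\<phi> n / of_nat n * of_real (mangoldt d) = w d * (\<phi> (n div d) / of_nat (n div d))"
          using n by (auto simp: w_def dchar_mult[OF assms(1)] field_simps)
      qed
      finally show "\<phi> n * of_real (ln (real n) / real n) = \<dots>" .
    qed
    also have "\<dots> = (\<Sum>d=1..N. w d * ?S (N div d))"
      by (subst sum_divisor_pairs) (simp add: sum_distrib_left)
    finally have "(\<Sum>d=1..N. w d) * L = (\<Sum>n=1..N. \<phi> n * of_real (ln (real n) / real n))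
        - (\<Sum>d=1..N. w d * (?S (N div d) - L))"
      by (simp add: sum_distrib_right right_diff_distrib sum_subtractf)
    hence "norm ((\<Sum>d=1..N. w d) * L) \<le> norm (\<Sum>n=1..N. \<phi> n * of_real (ln (real n) / real n))
        + norm (\<Sum>d=1..N. w d * (?S (N div d) - L))"
      by (simp only:) (rule norm_triangle_ineq4)
    also have "\<dots> \<le> C + 2 * real (m + 1) * 4"
      unfolding L_def
    proof (intro add_mono C norm_sum_mult_L1_tail_le[OF assms(1-3)])
      show "norm (w d) \<le> mangoldt d / real d" for d
        using mult_right_mono[OF norm_dchar_le[OF assms(1,2), of d], of "mangoldt d / real d"]
        by (simp add: w_def norm_mult norm_divide mangoldt_nonneg)
      show "(\<Sum>d=1..N. mangoldt d) \<le> 4 * real N" by (rule chebyshev_upper)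
    qed auto
    finally show ?thesis
      using assms(4) by (simp add: w_def L_def norm_mult field_simps)
  qed
  thus ?thesis by blast
qed

text \<open>
  If \<open>L(1) = 0\<close>, the convolution of \<open>moebius\<close> with \<open>ln (N / d)\<close> replaces the convolution of \<open>mangoldt\<close> with 1:
  it equals \<open>mangoldt n\<close> except for an extra \<open>ln N\<close> at \<open>n = 1\<close>.
\<close>
lemma sum_dchar_mangoldt_bounded_zero:
  assumes "dchar m \<phi>" "m > 0" "\<phi> \<noteq> principal_dchar m" "dirichlet_L1 \<phi> = 0" "N > 0"
  shows "norm ((\<Sum>n=1..N. \<phi> n * of_real (mangoldt n / real n)) + of_real (ln (real N))) \<le> 2 * real (m + 1)"
proof -
  let ?S = "\<lambda>M. \<Sum>k=1..M. \<phi> k / of_nat k"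
  define w where "w d = \<phi> d * of_real (of_int (moebius d) * ln (real N / real d) / real d)" for d
  have inner: "(\<Sum>d | d dvd n. of_int (moebius d) * ln (real N / real d)) 
      = mangoldt n + (if n = 1 then ln (real N) else 0)" if n: "n \<in> {1..N}" for n
  proof -
    \<comment> \<open>Here \<open>ln (N / d)\<close> is split as
      \<open>ln (n / d) + ln (N / n)\<close>. The second part is constant in \<open>d\<close>, so
      its Moebius sum vanishes unless \<open>n = 1\<close>, where it leaves
      \<open>ln N\<close>.\<close>
    have "(\<Sum>d | d dvd n. of_int (moebius d) * ln (real N / real d))
        = (\<Sum>d | d dvd n. of_int (moebius d) * ln (real (n div d)) + ln (real N / real n) * of_int (moebius d))"
    proof (intro sum.cong refl)
      fix d assume "d \<in> {d. d dvd n}"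
      then obtain k where k: "n = d * k" by auto
      thus "of_int (moebius d) * ln (real N / real d)
          = of_int (moebius d) * ln (real (n div d)) + ln (real N / real n) * of_int (moebius d)"
        using n by (auto simp: ln_div ln_mult algebra_simps)
    qed
    also have "\<dots> = mangoldt n + ln (real N / real n) * of_int (\<Sum>d | d dvd n. moebius d)"
      using n by (simp add: sum.distrib sum_mangoldt_moebius sum_distrib_left)
    also have "(\<Sum>d | d dvd n. moebius d) = (if n = 1 then 1 else 0)"
      using n by (intro sum_moebius_divisors) auto
    finally show ?thesis by auto
  qed
  have "(\<Sum>n=1..N. \<phi> n * of_real (mangoldt n / real n)) + of_real (ln (real N))
      = (\<Sum>n=1..N. \<phi> n * of_real (mangoldt n / real n)) + (\<Sum>n=1..N. if n = 1 then of_real (ln (real N)) else 0)"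
    using assms(5) by (simp add: sum.delta)
  also have "\<dots> = (\<Sum>n=1..N. \<phi> n / of_nat n * of_real (mangoldt n + (if n = 1 then ln (real N) else 0)))"
    unfolding sum.distrib [symmetric]
    by (intro sum.cong refl) (auto simp: dchar_1[OF assms(1)] algebra_simps)
  also have "\<dots> = (\<Sum>n=1..N. \<Sum>d | d dvd n. w d * (\<phi> (n div d) / of_nat (n div d)))"
  proof (intro sum.cong refl)
    fix n assume n: "n \<in> {1..N}"
    have "\<phi> n / of_nat n * of_real (mangoldt n + (if n = 1 then ln (real N) else 0))
        = (\<Sum>d | d dvd n. \<phi> n / of_nat n * of_real (of_int (moebius d) * ln (real N / real d)))"
      unfolding inner[OF n, symmetric] by (simp add: sum_distrib_left)
    also have "\<dots> = (\<Sum>d | d dvd n. w d * (\<phi> (n div d) / of_nat (n div d)))"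
    proof (intro sum.cong refl)
      fix d assume "d \<in> {d. d dvd n}"
      then obtain k where k: "n = d * k" by auto
      thus "\<phi> n / of_nat n * of_real (of_int (moebius d) * ln (real N / real d))
          = w d * (\<phi> (n div d) / of_nat (n div d))"
        using n by (auto simp: w_def dchar_mult[OF assms(1)] field_simps)
    qed
    finally show "\<phi> n / of_nat n * of_real (mangoldt n + (if n = 1 then ln (real N) else 0)) = \<dots>" .
  qed
  \<comment> \<open>The subtracted value is 0 by assumption; it only brings the sum into the form of
    the error estimate.\<close>
  also have "\<dots> = (\<Sum>d=1..N. w d * (?S (N div d) - dirichlet_L1 \<phi>))"
    using assms(4) by (subst sum_divisor_pairs) (simp add: sum_distrib_left)
  also have "norm \<dots> \<le> 2 * real (m + 1) * 1"
  proof (rule norm_sum_mult_L1_tail_le[OF assms(1-3)])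
    fix d assume d: "d \<in> {1..N}"
    have "norm (w d) = norm (\<phi> d) * \<bar>of_int (moebius d)\<bar> * (ln (real N / real d) / real d)"
      using d by (simp add: w_def norm_mult norm_divide abs_mult)
    also have "\<dots> \<le> 1 * 1 * (ln (real N / real d) / real d)"
    proof (intro mult_mono norm_dchar_le[OF assms(1,2)])
      show "\<bar>real_of_int (moebius d)\<bar> \<le> 1"
        using abs_moebius_le[of d] by linarith
    qed (use d in auto)
    finally show "norm (w d) \<le> ln (real N / real d) / real d" by simp
  next
    \<comment> \<open>The weights \<open>ln (N / d)\<close> have mean at most 1 by the lower bound
      \<open>N * ln N - N\<close> for \<open>ln (fact N)\<close>.\<close>
    have "(\<Sum>d=1..N. ln (real N / real d)) = (\<Sum>d=1..N. ln (real N) - ln (real d))"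
      using assms(5) by (intro sum.cong refl) (auto simp: ln_div)
    also have "\<dots> = real N * ln (real N) - (\<Sum>d=1..N. ln (real d))"
      by (simp add: sum_subtractf)
    also have "(\<Sum>d=1..N. ln (real d)) = ln (fact N)"
      by (rule ln_fact_conv_sum_ln [symmetric])
    finally show "(\<Sum>d=1..N. ln (real N / real d)) \<le> 1 * real N"
      using ln_fact_ge[of N] by simp
  qed auto
  finally show ?thesis by simp
qed

text \<open>Compared with Mertens' sum, the terms with \<open>n\<close> not coprime to
  \<open>m\<close> are missing. Among them nonprimes contribute boundedly, and the primes are the
  finitely many divisors of \<open>m\<close>.\<close>

lemma sum_principal_dchar_mangoldt:
  assumes "m > 0"
  shows "\<exists>C. \<forall>N>0. norm ((\<Sum>n=1..N. principal_dchar m n * of_real (mangoldt n / real n)) - of_real (ln (real N))) \<le> C"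
proof -
  obtain C where C: "\<And>N. (\<Sum>n | n \<in> {1..N} \<and> \<not> prime n. mangoldt n / real n) \<le> (C :: real)"
    using mangoldt_nonprime_sum_bounded by blast
  define D where "D = (\<Sum>p\<in>prime_factors m. mangoldt p / real p :: real)"
  have "norm ((\<Sum>n=1..N. principal_dchar m n * of_real (mangoldt n / real n)) - of_real (ln (real N))) \<le> C + D + 4"
    if "N > 0" for N
  proof -
    define E where "E = (\<Sum>n | n \<in> {1..N} \<and> \<not> coprime n m. mangoldt n / real n :: real)"
    have "{n. n \<in> {1..N} \<and> \<not> coprime n m} \<inter> {n. prime n} \<subseteq> prime_factors m"
      using assms by (auto simp: prime_factors_dvd dest: prime_imp_coprime)
    hence "E \<le> (\<Sum>n\<in>{n. n \<in> {1..N} \<and> \<not> prime n} \<union> prime_factors m. mangoldt n / real n)"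
      unfolding E_def by (intro sum_mono2) (auto simp: mangoldt_nonneg)
    also have "\<dots> = (\<Sum>n | n \<in> {1..N} \<and> \<not> prime n. mangoldt n / real n) + D"
      unfolding D_def by (intro sum.union_disjoint) auto
    also have "\<dots> \<le> C + D" using C by simp
    finally have "E \<le> C + D" .
    moreover have "E \<ge> 0" unfolding E_def by (intro sum_nonneg) (auto simp: mangoldt_nonneg)
    moreover have eq: "(\<Sum>n=1..N. principal_dchar m n * of_real (mangoldt n / real n))
        = of_real ((\<Sum>n=1..N. mangoldt n / real n) - E)"
    proof -
      have "E = (\<Sum>n=1..N. if \<not> coprime n m then mangoldt n / real n else 0)"
        unfolding E_def by (subst sum.inter_filter [symmetric]) auto
      hence "(\<Sum>n=1..N. mangoldt n / real n) - E = (\<Sum>n=1..N. if coprime n m then mangoldt n / real n else 0)"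
        by (simp only: sum_subtractf [symmetric]) (intro sum.cong, auto)
      thus ?thesis
        by (simp only: of_real_sum) (intro sum.cong, auto simp: principal_dchar_def)
    qed
    moreover note mertens_mangoldt[OF that]
    ultimately have "\<bar>(\<Sum>n=1..N. mangoldt n / real n) - E - ln (real N)\<bar> \<le> C + D + 4"
      by linarith
    thus ?thesis unfolding eq by (simp only: of_real_diff [symmetric] norm_of_real)
  qed
  thus ?thesis by blast
qed

section \<open>Nonvanishing for real characters\<close>

text \<open>Every divisor of \<open>p ^ k * n\<close> is uniquely \<open>p ^ i * d\<close> with
  \<open>i \<le> k\<close> and \<open>d\<close> dividing \<open>n\<close>; the exponent is recovered
  as a multiplicity.\<close>

lemma sum_divisors_prime_power_mult:
  fixes c :: "nat \<Rightarrow> real"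
  assumes mult: "\<And>a b. c (a * b) = c a * c b" and "c 1 = 1"
    and "prime p" "\<not> p dvd n" "n > 0"
  shows "(\<Sum>d | d dvd p ^ k * n. c d) = (\<Sum>i\<le>k. c p ^ i) * (\<Sum>d | d dvd n. c d)"
proof -
  have pow: "c (p ^ i) = c p ^ i" for i by (induction i) (use assms(1,2) in auto)
  have "p > 0" using assms(3) by (simp add: prime_gt_0_nat)
  have nu: "multiplicity p (p ^ i * d) = i" if "d dvd n" for i d
  proof -
    have "\<not> p dvd d" using that assms(4) dvd_trans by blast
    thus ?thesis using assms(3) by (intro multiplicity_eqI) auto
  qed
  have "(\<Sum>i\<le>k. c p ^ i) * (\<Sum>d | d dvd n. c d) = (\<Sum>(i,d)\<in>{..k} \<times> {d. d dvd n}. c p ^ i * c d)"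
    by (simp add: sum_product sum.cartesian_product)
  also have "\<dots> = (\<Sum>d | d dvd p ^ k * n. c d)"
  proof (rule sum.reindex_bij_witness[of _ "\<lambda>d. (multiplicity p d, d div p ^ multiplicity p d)" "\<lambda>(i,d). p ^ i * d"])
    fix x assume x: "x \<in> {..k} \<times> {d. d dvd n}"
    obtain i d where [simp]: "x = (i, d)" by (cases x) auto
    from x have id: "i \<le> k" "d dvd n" by auto
    show "(multiplicity p (case x of (i, d) \<Rightarrow> p ^ i * d),
           (case x of (i, d) \<Rightarrow> p ^ i * d) div p ^ multiplicity p (case x of (i, d) \<Rightarrow> p ^ i * d)) = x"
      using id \<open>p > 0\<close> by (simp add: nu)
    show "(case x of (i, d) \<Rightarrow> p ^ i * d) \<in> {d. d dvd p ^ k * n}"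
      using id by (auto intro: mult_dvd_mono le_imp_power_dvd)
    show "c (case x of (i, d) \<Rightarrow> p ^ i * d) = (case x of (i, d) \<Rightarrow> c p ^ i * c d)"
      by (simp add: mult pow)
  next
    fix d assume d: "d \<in> {d. d dvd p ^ k * n}"
    have "d \<noteq> 0" using d assms(5) \<open>p > 0\<close>
      by (metis dvd_0_left mem_Collect_eq mult_is_0 not_gr_zero power_not_zero)
    then obtain e where e: "d = p ^ multiplicity p d * e" "\<not> p dvd e"
      using assms(3) by (metis multiplicity_decompose' not_prime_unit)
    have "multiplicity p d \<le> multiplicity p (p ^ k * n)"
      using d assms(5) \<open>p > 0\<close> by (intro dvd_imp_multiplicity_le) auto
    also have "\<dots> = k" by (rule nu) simp
    finally have "multiplicity p d \<le> k" .
    have "e dvd p ^ k * n" using d e(1) by (metis dvd_mult_right mem_Collect_eq)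
    moreover have "coprime e (p ^ k)"
      using prime_imp_coprime[OF assms(3) e(2)] by (simp add: coprime_commute)
    ultimately have "e dvd n" by (simp add: coprime_dvd_mult_right_iff)
    have "d div p ^ multiplicity p d = e" using e(1) \<open>p > 0\<close> 
      by (metis nonzero_mult_div_cancel_left power_not_zero not_gr_zero)
    thus "(multiplicity p d, d div p ^ multiplicity p d) \<in> {..k} \<times> {d. d dvd n}"
      "(case (multiplicity p d, d div p ^ multiplicity p d) of (i, d) \<Rightarrow> p ^ i * d) = d"
      using \<open>multiplicity p d \<le> k\<close> \<open>e dvd n\<close> e(1) by simp_all
  qed
  finally show ?thesis ..
qed

text \<open>The divisor sum is multiplicative, and at \<open>p ^ k\<close> it is
  \<open>k + 1\<close>, 1, or the indicator of even \<open>k\<close>, according as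
  \<open>c p\<close> is 1, 0 or -1. The induction strips one prime power at a time; squares have
  only even exponents.\<close>

lemma sum_divisors_real_character_ge:
  fixes c :: "nat \<Rightarrow> real"
  assumes mult: "\<And>a b. c (a * b) = c a * c b" and one: "c 1 = 1" and vals: "\<And>a. c a \<in> {-1, 0, 1}"
    and "n > 0"
  shows "(if \<exists>s. n = s ^ 2 then 1 else 0) \<le> (\<Sum>d | d dvd n. c d)"
  using assms(4)
proof (induction n rule: less_induct)
  case (less n)
  show ?case
  proof (cases "n = 1")
    case True
    thus ?thesis using one by simp
  next
    case False
    then obtain p where p: "prime p" "p dvd n" by (metis prime_factor_nat)
    define k where "k = multiplicity p n"
    obtain n' where n': "n = p ^ k * n'" "\<not> p dvd n'"
      using less.prems p(1) unfolding k_def by (metis multiplicity_decompose' not_prime_unit not_gr_zero)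
    have "k > 0" using p less.prems unfolding k_def by (simp add: prime_multiplicity_gt_zero_iff)
    have "n' > 0" using n' less.prems by (auto intro!: Nat.gr0I)
    moreover have "n' < n"
      using n'(1) \<open>n' > 0\<close> one_less_power[OF prime_gt_1_nat[OF p(1)] \<open>k > 0\<close>] by simp
    ultimately have IH: "(if \<exists>s. n' = s ^ 2 then 1 else 0) \<le> (\<Sum>d | d dvd n'. c d)"
      using less.IH by blast
    have eq: "(\<Sum>d | d dvd n. c d) = (\<Sum>i\<le>k. c p ^ i) * (\<Sum>d | d dvd n'. c d)"
      unfolding n'(1) using sum_divisors_prime_power_mult[OF mult one p(1) n'(2) \<open>n' > 0\<close>] .
    have geo: "(if even k then 1 else 0) \<le> (\<Sum>i\<le>k. c p ^ i)"
    proof -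
      consider "c p = -1" | "c p = 0" | "c p = 1" using vals[of p] by auto
      thus ?thesis
      proof cases
        case 1
        have "(\<Sum>i\<le>k. (-1) ^ i) = (if even k then 1 else 0 :: real)" by (induction k) auto
        thus ?thesis using 1 by simp
      next
        case 2
        have "(\<Sum>i\<le>k. 0 ^ i) = (1 :: real)" by (induction k) auto
        thus ?thesis using 2 by simp
      qed auto
    qed
    show ?thesis
    proof (cases "\<exists>s. n = s ^ 2")
      case True
      then obtain s where s: "n = s ^ 2" by blast
      have "s \<noteq> 0" using s less.prems by auto
      define j where "j = multiplicity p s"
      obtain s' where s': "s = p ^ j * s'" "\<not> p dvd s'"
        using \<open>s \<noteq> 0\<close> p(1) unfolding j_def by (metis multiplicity_decompose' not_prime_unit)
      have k: "k = 2 * j"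
        unfolding k_def j_def s using p(1) \<open>s \<noteq> 0\<close> by (simp add: prime_elem_multiplicity_power_distrib)
      have "p ^ k * n' = s ^ 2" using n'(1) s by simp
      also have "\<dots> = p ^ k * s' ^ 2"
        unfolding k by (subst s'(1)) (simp add: power_mult_distrib power_mult [symmetric] mult.commute)
      finally have "p ^ k * n' = p ^ k * s' ^ 2" .
      hence "n' = s' ^ 2" using p(1) by (simp add: prime_gt_0_nat)
      hence "1 \<le> (\<Sum>d | d dvd n'. c d)" using IH by auto
      moreover have "1 \<le> (\<Sum>i\<le>k. c p ^ i)" using geo k by simp
      ultimately show ?thesis unfolding eq using True mult_mono[of 1 "\<Sum>i\<le>k. c p ^ i" 1 "\<Sum>d | d dvd n'. c d"] by simp
    next
      case False
      have "0 \<le> (\<Sum>i\<le>k. c p ^ i)" using geo by (simp split: if_splits)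
      moreover have "0 \<le> (\<Sum>d | d dvd n'. c d)" using IH by (simp split: if_splits)
      ultimately show ?thesis unfolding eq using False by simp
    qed
  qed
qed

section \<open>Sums of inverse square roots\<close>

lemma inverse_sqrt_Suc_le: "1 / sqrt (real (Suc y)) \<le> 2 * (sqrt (real (Suc y)) - sqrt (real y))"
proof -
  have "sqrt (real (Suc y)) * (2 * (sqrt (real (Suc y)) - sqrt (real y))) - 1
      = (sqrt (real (Suc y)) - sqrt (real y)) ^ 2"
    by (simp add: power2_diff algebra_simps flip: power2_eq_square)
  hence "1 \<le> sqrt (real (Suc y)) * (2 * (sqrt (real (Suc y)) - sqrt (real y)))"
    by (metis diff_ge_0_iff_ge zero_le_power2)
  thus ?thesis by (simp add: field_simps del: of_nat_Suc)
qed

text \<open>The decreasing \<open>a\<close> and the increasing \<open>b\<close> enclose the constant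
  \<open>C\<close>. The argument \<open>x\<close> is real with integer part \<open>y\<close>, since
  the estimate is applied at \<open>x = N / d\<close>.\<close>

lemma sum_inverse_sqrt_asymp:
  obtains C :: real where
    "\<And>x y. x \<ge> 1 \<Longrightarrow> real y \<le> x \<Longrightarrow> x < real y + 1 \<Longrightarrow> \<bar>(\<Sum>k=1..y. 1 / sqrt (real k)) - 2 * sqrt x - C\<bar> \<le> 2 / sqrt x"
proof -
  define H where "H y = (\<Sum>k=1..y. 1 / sqrt (real k))" for y :: nat
  define a where "a y = H y - 2 * sqrt (real y)" for y
  define b where "b y = H y - 2 * sqrt (real (Suc y))" for y
  have diff: "2 * (sqrt (real (Suc y)) - sqrt (real y)) \<le> 1 / sqrt (real y)" if "y > 0" for y
  proof -
    have "1 - sqrt (real y) * (2 * (sqrt (real (Suc y)) - sqrt (real y)))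
        = (sqrt (real (Suc y)) - sqrt (real y)) ^ 2"
      by (simp add: power2_diff algebra_simps flip: power2_eq_square)
    hence "sqrt (real y) * (2 * (sqrt (real (Suc y)) - sqrt (real y))) \<le> 1"
      by (metis diff_ge_0_iff_ge zero_le_power2)
    thus ?thesis using that by (simp add: field_simps del: of_nat_Suc)
  qed
  have "decseq a"
  proof (rule decseq_SucI)
    show "a (Suc y) \<le> a y" for y
      using inverse_sqrt_Suc_le[of y] by (simp add: a_def H_def del: of_nat_Suc)
  qed
  have "incseq b"
  proof (rule incseq_SucI)
    show "b y \<le> b (Suc y)" for y
      using diff[of "Suc y"] by (simp add: b_def H_def del: of_nat_Suc)
  qed
  have ba: "b y \<le> a y" for y by (simp add: a_def b_def)
  have "b 0 \<le> a y" for y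
    using incseqD[OF \<open>incseq b\<close>, of 0 y] ba[of y] by linarith
  then obtain C where C: "a \<longlonglongrightarrow> C" "\<And>y. C \<le> a y"
    using decseq_convergent[OF \<open>decseq a\<close>] by metis
  have C': "b y \<le> C" for y
  proof (rule LIMSEQ_le_const[OF C(1)])
    have "b y \<le> a z" if "z \<ge> y" for z
      using incseqD[OF \<open>incseq b\<close> that] ba[of z] by linarith
    thus "\<exists>N. \<forall>z\<ge>N. b y \<le> a z" by blast
  qed
  have "\<bar>H y - 2 * sqrt x - C\<bar> \<le> 2 / sqrt x" if xy: "x \<ge> 1" "real y \<le> x" "x < real y + 1" for x y
  proof -
    have "y > 0" using xy by (cases y) auto
    have "sqrt (real y) \<le> sqrt x" "sqrt x \<le> sqrt (real (Suc y))" using xy by auto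
    hence "b y \<le> H y - 2 * sqrt x" "H y - 2 * sqrt x \<le> a y" by (auto simp: a_def b_def)
    moreover have "a y - b y \<le> 1 / sqrt (real y)"
      using diff[OF \<open>y > 0\<close>] by (simp add: a_def b_def del: of_nat_Suc)
    moreover have "1 / sqrt (real y) \<le> 2 / sqrt x"
    proof -
      \<comment> \<open>From \<open>y \<ge> 1\<close> follows \<open>x < y + 1 \<le> 4 * y\<close>;
        the square 4 is taken to get a rational constant.\<close>
      have "sqrt x \<le> sqrt (2 ^ 2 * real y)" using xy \<open>y > 0\<close> by (intro real_sqrt_le_mono) auto
      also have "\<dots> = 2 * sqrt (real y)" by (simp add: real_sqrt_mult)
      finally show ?thesis using xy \<open>y > 0\<close> by (simp add: field_simps)
    qed
    ultimately show ?thesis using C(2)[of y] C'[of y] by linarith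
  qed
  thus ?thesis using that unfolding H_def by blast
qed

lemma sum_inverse_sqrt_le: "(\<Sum>k=1..M. 1 / sqrt (real k)) \<le> 2 * sqrt (real M)"
proof (induction M)
  case (Suc M)
  show ?case using Suc inverse_sqrt_Suc_le[of M] by (simp del: of_nat_Suc)
qed auto


text \<open>
  The sum of \<open>(\<Sum>d | d dvd n. c d) / sqrt n\<close> over \<open>n \<le> M\<^sup>2\<close> dominates the harmonic sum, because squares
  contribute at least 1 each.  The hyperbola method, splitting at \<open>d = M\<close>, shows that it would stay
  bounded if \<open>L(1)\<close> vanished.
\<close>
lemma dirichlet_L1_real_nonzero:
  assumes \<phi>: "dchar m \<phi>" and m: "m > 0" and np: "\<phi> \<noteq> principal_dchar m"
    and real: "\<And>a. cnj (\<phi> a) = \<phi> a"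
  shows "dirichlet_L1 \<phi> \<noteq> 0"
proof
  assume L: "dirichlet_L1 \<phi> = 0"
  define c where "c a = Re (\<phi> a)" for a
  have c: "of_real (c a) = \<phi> a" for a
    using real[of a] by (simp add: c_def complex_eq_iff)
  have mult: "c (a * b) = c a * c b" for a b
    using dchar_mult[OF \<phi>, of a b] by (metis c of_real_eq_iff of_real_mult)
  have one: "c 1 = 1" using dchar_1[OF \<phi>] by (simp add: c_def)
  have vals: "c a \<in> {-1, 0, 1}" for a
  proof (cases "coprime a m")
    case True
    hence "\<bar>c a\<bar> = 1" using norm_dchar[OF \<phi> True m] by (metis c norm_of_real)
    thus ?thesis by (auto simp: abs_if split: if_splits)
  qed (use dchar_eq_0_iff[OF \<phi>, of a] in \<open>auto simp: c_def\<close>)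
  define B where "B = real (m + 1)"
  have part: "\<bar>\<Sum>n=Suc M..N. c n / sqrt (real n)\<bar> \<le> 2 * B / sqrt (real (Suc M))" for M N
  proof -
    have "norm (\<Sum>n=Suc M..N. \<phi> n * of_real (1 / sqrt (real n))) \<le> 2 * B * (1 / sqrt (real (Suc M)))"
      unfolding B_def
      by (rule abel_summation_bound[OF norm_sum_nonprincipal_dchar_le[OF \<phi> m np]])
         (auto simp: frac_le)
    also have "(\<Sum>n=Suc M..N. \<phi> n * of_real (1 / sqrt (real n))) = of_real (\<Sum>n=Suc M..N. c n / sqrt (real n))"
      by (simp add: c)
    finally show ?thesis by (simp only: norm_of_real) simp
  qed
  have partL: "\<bar>\<Sum>n=1..M. c n / real n\<bar> \<le> 2 * B / real (Suc M)" for M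
  proof -
    have "norm ((\<Sum>n=1..M. \<phi> n / of_nat n) - dirichlet_L1 \<phi>) \<le> 2 * B / real (Suc M)"
      unfolding B_def by (rule dirichlet_L1_tail(1)[OF \<phi> m np])
    also have "(\<Sum>n=1..M. \<phi> n / of_nat n) - dirichlet_L1 \<phi> = of_real (\<Sum>n=1..M. c n / real n)"
      using L by (simp add: c)
    finally show ?thesis by (simp only: norm_of_real)
  qed
  define H where "H y = (\<Sum>k=1..y. 1 / sqrt (real k))" for y :: nat
  obtain C where C: "\<And>x y. x \<ge> 1 \<Longrightarrow> real y \<le> x \<Longrightarrow> x < real y + 1 \<Longrightarrow> \<bar>H y - 2 * sqrt x - C\<bar> \<le> 2 / sqrt x"
    using sum_inverse_sqrt_asymp unfolding H_def by metis
  have bound: "(\<Sum>k=1..M. 1 / real k) \<le> 8 * B + 2 * B * \<bar>C\<bar> + 2" if M: "M > 0" for M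
  proof -
    define N where "N = M ^ 2"
    have "M \<le> N" by (simp add: N_def power2_eq_square)
    have "(\<Sum>k=1..M. 1 / real k) = (\<Sum>n\<in>(\<lambda>k. k ^ 2) ` {1..M}. 1 / sqrt (real n))"
      by (subst sum.reindex) (auto simp: inj_on_def)
    also have "\<dots> \<le> (\<Sum>n\<in>(\<lambda>k. k ^ 2) ` {1..M}. (\<Sum>d | d dvd n. c d) / sqrt (real n))"
    proof (intro sum_mono divide_right_mono)
      fix n assume "n \<in> (\<lambda>k. k ^ 2) ` {1..M}"
      hence "n > 0" "\<exists>s. n = s ^ 2" by auto
      thus "1 \<le> (\<Sum>d | d dvd n. c d)"
        using sum_divisors_real_character_ge[OF mult one vals, of n] by simp
    qed auto
    also have "\<dots> \<le> (\<Sum>n=1..N. (\<Sum>d | d dvd n. c d) / sqrt (real n))"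
    proof (intro sum_mono2)
      show "(\<lambda>k. k ^ 2) ` {1..M} \<subseteq> {1..N}" by (auto simp: N_def power_mono)
      fix n assume "n \<in> {1..N} - (\<lambda>k. k ^ 2) ` {1..M}"
      hence "0 \<le> (\<Sum>d | d dvd n. c d)"
        using sum_divisors_real_character_ge[OF mult one vals, of n] by (simp split: if_splits)
      thus "0 \<le> (\<Sum>d | d dvd n. c d) / sqrt (real n)" by simp
    qed auto
    also have "\<dots> = (\<Sum>n=1..N. \<Sum>d | d dvd n. c d / sqrt (real d) * (1 / sqrt (real (n div d))))"
      unfolding sum_divide_distrib
    proof (intro sum.cong refl)
      fix n d assume "n \<in> {1..N}" "d \<in> {d. d dvd n}"
      then obtain k where k: "n = d * k" by auto
      thus "c d / sqrt (real n) = c d / sqrt (real d) * (1 / sqrt (real (n div d)))"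
        using \<open>n \<in> {1..N}\<close> by (auto simp: real_sqrt_mult)
    qed
    also have "\<dots> = (\<Sum>d=1..N. \<Sum>k=1..N div d. c d / sqrt (real d) * (1 / sqrt (real k)))"
      by (rule sum_divisor_pairs)
    also have "\<dots> = (\<Sum>d=1..M. \<Sum>k=1..N div d. c d / sqrt (real d) * (1 / sqrt (real k)))
        + (\<Sum>d=Suc M..N. \<Sum>k=1..N div d. c d / sqrt (real d) * (1 / sqrt (real k)))"
      using \<open>M \<le> N\<close> by (rule sum_split_at)
    also have "(\<Sum>d=1..M. \<Sum>k=1..N div d. c d / sqrt (real d) * (1 / sqrt (real k)))
        = (\<Sum>d=1..M. c d / sqrt (real d) * H (N div d))"
      by (simp add: H_def sum_distrib_left)
    \<comment> \<open>With \<open>N = M ^ 2\<close> the square root of \<open>N / d\<close> is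
      \<open>M / sqrt d\<close>, so the main term is \<open>2 * M\<close> times a partial sum of
      \<open>L(1)\<close>. As \<open>L(1) = 0\<close>, that partial sum is only of order
      \<open>1 / M\<close>: this is where the assumption enters.\<close>
    also have "\<dots> \<le> 4 * B + 2 * B * \<bar>C\<bar> + 2"
    proof -
      define r where "r d = H (N div d) - 2 * (real M / sqrt (real d)) - C" for d
      have r: "\<bar>r d\<bar> \<le> 2 * sqrt (real d) / real M" if d: "d \<in> {1..M}" for d
      proof -
        define x where "x = real N / real d"
        have sx: "sqrt x = real M / sqrt (real d)" by (simp add: x_def N_def real_sqrt_divide)
        have "real d \<le> real N" using d \<open>M \<le> N\<close> by auto
        hence "x \<ge> 1" using d by (simp add: x_def)
        moreover have "real (N div d) \<le> x" unfolding x_def by (rule of_nat_div_le_of_nat)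
        moreover have "x < real (N div d) + 1"
          using d unfolding x_def by (intro real_divide_less_div_plus_one) auto
        ultimately have "\<bar>H (N div d) - 2 * sqrt x - C\<bar> \<le> 2 / sqrt x" by (rule C)
        thus ?thesis unfolding sx by (simp add: r_def)
      qed
      have err: "(\<Sum>d=1..M. c d / sqrt (real d) * r d) \<le> (\<Sum>d=1..M. 2 / real M)"
      proof (intro sum_mono)
        fix d assume d: "d \<in> {1..M}"
        have "c d / sqrt (real d) * r d \<le> \<bar>c d / sqrt (real d) * r d\<bar>" by (rule abs_ge_self)
        also have "\<dots> = \<bar>c d\<bar> / sqrt (real d) * \<bar>r d\<bar>" by (simp add: abs_mult)
        also have "\<dots> \<le> 1 / sqrt (real d) * (2 * sqrt (real d) / real M)"
          using vals[of d] by (intro mult_mono r d divide_right_mono) auto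
        also have "\<dots> = 2 / real M" using d by simp
        finally show "c d / sqrt (real d) * r d \<le> 2 / real M" .
      qed
      have "(\<Sum>d=1..M. c d / sqrt (real d) * H (N div d))
          = (\<Sum>d=1..M. 2 * real M * (c d / real d) + C * (c d / sqrt (real d)) + c d / sqrt (real d) * r d)"
        by (intro sum.cong refl) (simp add: r_def algebra_simps divide_simps)
      also have "\<dots> = 2 * real M * (\<Sum>d=1..M. c d / real d) + C * (\<Sum>d=1..M. c d / sqrt (real d))
          + (\<Sum>d=1..M. c d / sqrt (real d) * r d)"
        by (simp only: sum.distrib sum_distrib_left)
      also have "\<dots> \<le> 4 * B + 2 * B * \<bar>C\<bar> + 2"
      proof (intro add_mono)
        have "2 * real M * (\<Sum>d=1..M. c d / real d) \<le> 2 * real M * (2 * B / real (Suc M))"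
          using partL[of M] by (intro mult_left_mono) auto
        also have "\<dots> \<le> 4 * B" by (simp add: B_def field_simps)
        finally show "2 * real M * (\<Sum>d=1..M. c d / real d) \<le> 4 * B" .
        have "C * (\<Sum>d=1..M. c d / sqrt (real d)) \<le> \<bar>C\<bar> * \<bar>\<Sum>d=Suc 0..M. c d / sqrt (real d)\<bar>"
          by (metis One_nat_def abs_ge_self abs_mult)
        also have "\<dots> \<le> \<bar>C\<bar> * (2 * B / sqrt (real (Suc 0)))"
          by (intro mult_left_mono part) auto
        finally show "C * (\<Sum>d=1..M. c d / sqrt (real d)) \<le> 2 * B * \<bar>C\<bar>" by (simp add: mult_ac)
        show "(\<Sum>d=1..M. c d / sqrt (real d) * r d) \<le> 2" using err M by simp
      qed
      finally show ?thesis .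
    qed
    \<comment> \<open>For \<open>d > M\<close> the condition \<open>d * k \<le> M ^ 2\<close> forces
      \<open>k \<le> M\<close>. Summing over \<open>d\<close> inside exploits the cancellation in
      \<open>c\<close>, giving order \<open>1 / sqrt M\<close>, against an outer sum of order
      \<open>sqrt M\<close>.\<close>
    also have "(\<Sum>d=Suc M..N. \<Sum>k=1..N div d. c d / sqrt (real d) * (1 / sqrt (real k)))
        = (\<Sum>k=1..M. 1 / sqrt (real k) * (\<Sum>d=Suc M..N div k. c d / sqrt (real d)))"
    proof -
      have k_le: "k \<le> M" and d_le_div: "d \<le> N div k"
        if "M < d" "0 < k" "k \<le> N div d" for d k
      proof -
        have dk: "d * k \<le> N" using that by (simp add: less_eq_div_iff_mult_less_eq mult.commute)
        thus "d \<le> N div k" using that by (simp add: less_eq_div_iff_mult_less_eq)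
        show "k \<le> M"
        proof (rule ccontr)
          assume "\<not> k \<le> M"
          hence "M * M < d * k" using \<open>M < d\<close> by (intro mult_strict_mono) auto
          thus False using dk by (simp add: N_def power2_eq_square)
        qed
      qed
      have d_le: "d \<le> N" and k_le_div: "k \<le> N div d"
        if "M < d" "0 < k" "d \<le> N div k" for d k
      proof -
        have dk: "d * k \<le> N" using that by (simp add: less_eq_div_iff_mult_less_eq)
        thus "k \<le> N div d" using that by (simp add: less_eq_div_iff_mult_less_eq mult.commute)
        have "d \<le> d * k" using that by simp
        thus "d \<le> N" using dk by (rule order_trans)
      qed
      have "(\<Sum>d=Suc M..N. \<Sum>k=1..N div d. c d / sqrt (real d) * (1 / sqrt (real k)))
          = (\<Sum>(d,k)\<in>(SIGMA d:{Suc M..N}. {1..N div d}). c d / sqrt (real d) * (1 / sqrt (real k)))"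
        by (subst sum.Sigma) auto
      also have "\<dots> = (\<Sum>(k,d)\<in>(SIGMA k:{1..M}. {Suc M..N div k}). c d / sqrt (real d) * (1 / sqrt (real k)))"
        by (rule sum.reindex_bij_witness[of _ "\<lambda>(x,y). (y,x)" "\<lambda>(x,y). (y,x)"])
           (auto simp: Suc_le_eq intro: k_le d_le_div d_le k_le_div)
      also have "\<dots> = (\<Sum>k=1..M. \<Sum>d=Suc M..N div k. c d / sqrt (real d) * (1 / sqrt (real k)))"
        by (subst sum.Sigma) auto
      finally show ?thesis by (simp add: sum_distrib_left mult.commute)
    qed
    also have "\<dots> \<le> (\<Sum>k=1..M. 1 / sqrt (real k) * (2 * B / sqrt (real (Suc M))))"
      using part by (intro sum_mono mult_left_mono) (auto intro: order_trans[OF abs_ge_self])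
    also have "\<dots> = H M * (2 * B / sqrt (real (Suc M)))"
      by (simp only: H_def sum_distrib_right)
    also have "\<dots> \<le> 2 * sqrt (real (Suc M)) * (2 * B / sqrt (real (Suc M)))"
    proof (intro mult_right_mono)
      have "H M \<le> 2 * sqrt (real M)" unfolding H_def by (rule sum_inverse_sqrt_le)
      also have "\<dots> \<le> 2 * sqrt (real (Suc M))" by simp
      finally show "H M \<le> 2 * sqrt (real (Suc M))" .
    qed (simp add: B_def)
    also have "\<dots> = 4 * B" by (simp del: of_nat_Suc)
    finally show ?thesis by simp
  qed
  have "ln (real (Suc M)) \<le> 8 * B + 2 * B * \<bar>C\<bar> + 2" if "M > 0" for M
    using bound[OF that] ln_le_harm[of M] by (simp add: harm_def inverse_eq_divide add.commute)
  hence "eventually (\<lambda>M. ln (real (Suc M)) \<le> 8 * B + 2 * B * \<bar>C\<bar> + 2) sequentially"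
    using eventually_gt_at_top[of 0] by (rule eventually_mono[rotated])
  moreover have "filterlim (\<lambda>M. ln (real (Suc M))) at_top sequentially" by real_asymp
  hence "eventually (\<lambda>M. ln (real (Suc M)) > 8 * B + 2 * B * \<bar>C\<bar> + 2) sequentially"
    by (simp add: filterlim_at_top_dense)
  ultimately have "eventually (\<lambda>M. False) sequentially" by eventually_elim simp
  thus False by simp
qed

section \<open>Dirichlet's theorem for odd moduli\<close>

text \<open>The coefficient of \<open>ln N\<close> in the sum of
  \<open>\<phi> n * mangoldt n / n\<close> over \<open>n \<le> N\<close>. The value -1 is ruled out
  for odd moduli only later.\<close>

definition mangoldt_coeff :: "nat \<Rightarrow> (nat \<Rightarrow> complex) \<Rightarrow> real" where
  "mangoldt_coeff m \<phi> = (if \<phi> = principal_dchar m then 1 else if dirichlet_L1 \<phi> = 0 then -1 else 0)"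

lemma sum_dchar_mangoldt_asymp:
  assumes "dchar m \<phi>" "m > 0"
  shows "\<exists>C. \<forall>N>0. norm ((\<Sum>n=1..N. \<phi> n * of_real (mangoldt n / real n)) - of_real (mangoldt_coeff m \<phi> * ln (real N))) \<le> C"
proof (cases "\<phi> = principal_dchar m")
  case True
  thus ?thesis using sum_principal_dchar_mangoldt[OF assms(2)] by (simp add: mangoldt_coeff_def)
next
  case False
  show ?thesis
  proof (cases "dirichlet_L1 \<phi> = 0")
    case True
    thus ?thesis using False sum_dchar_mangoldt_bounded_zero[OF assms False True]
      by (auto simp: mangoldt_coeff_def simp del: of_real_mangoldt)
  next
    case nz: False
    thus ?thesis using False sum_dchar_mangoldt_bounded[OF assms False nz]
      by (auto simp: mangoldt_coeff_def)
  qed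
qed

text \<open>Orthogonality applied at \<open>b * n\<close> isolates the residue class inverse to
  \<open>b\<close>; each character then contributes its own multiple of \<open>ln N\<close> up to a
  bounded error.\<close>

lemma sum_mangoldt_residue_asymp:
  assumes "odd m"
  shows "\<exists>C. \<forall>N>0. norm (of_real (real (card {\<phi>. dchar m \<phi>}) * (\<Sum>n | n \<in> {1..N} \<and> [b * n = 1] (mod m). mangoldt n / real n))
      - (\<Sum>\<phi> | dchar m \<phi>. \<phi> b * of_real (mangoldt_coeff m \<phi>)) * of_real (ln (real N))) \<le> C"
proof -
  have m: "m > 0" using assms(1) by (auto intro!: Nat.gr0I)
  let ?X = "{\<phi>. dchar m \<phi>}"
  have "\<forall>\<phi>\<in>?X. \<exists>C. \<forall>N>0. norm ((\<Sum>n=1..N. \<phi> n * of_real (mangoldt n / real n)) - of_real (mangoldt_coeff m \<phi> * ln (real N))) \<le> C"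
    using sum_dchar_mangoldt_asymp[OF _ m] by blast
  from bchoice[OF this] obtain C where "\<forall>\<phi>\<in>?X. \<forall>N>0. norm ((\<Sum>n=1..N. \<phi> n * of_real (mangoldt n / real n)) - of_real (mangoldt_coeff m \<phi> * ln (real N))) \<le> C \<phi>"
    by blast
  hence C: "norm ((\<Sum>n=1..N. \<phi> n * of_real (mangoldt n / real n)) - of_real (mangoldt_coeff m \<phi> * ln (real N))) \<le> C \<phi>"
    if "dchar m \<phi>" "N > 0" for \<phi> N using that by blast
  have "norm (of_real (real (card ?X) * (\<Sum>n | n \<in> {1..N} \<and> [b * n = 1] (mod m). mangoldt n / real n))
      - (\<Sum>\<phi>\<in>?X. \<phi> b * of_real (mangoldt_coeff m \<phi>)) * of_real (ln (real N))) \<le> (\<Sum>\<phi>\<in>?X. C \<phi>)" if N: "N > 0" for N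
  proof -
    have "(\<Sum>\<phi>\<in>?X. \<phi> b * (\<Sum>n=1..N. \<phi> n * of_real (mangoldt n / real n)))
        = (\<Sum>\<phi>\<in>?X. \<Sum>n=1..N. \<phi> (b * n) * of_real (mangoldt n / real n))"
      by (intro sum.cong refl) (simp add: sum_distrib_left dchar_mult mult.assoc)
    also have "\<dots> = (\<Sum>n=1..N. (\<Sum>\<phi>\<in>?X. \<phi> (b * n)) * of_real (mangoldt n / real n))"
      by (subst sum.swap) (simp only: sum_distrib_right)
    also have "\<dots> = (\<Sum>n=1..N. if [b * n = 1] (mod m) then of_nat (card ?X) * of_real (mangoldt n / real n) else 0)"
      by (intro sum.cong refl) (simp add: sum_dchars[OF assms])
    also have "\<dots> = (\<Sum>n | n \<in> {1..N} \<and> [b * n = 1] (mod m). of_nat (card ?X) * of_real (mangoldt n / real n))"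
      by (subst sum.inter_filter [symmetric]) auto
    also have "\<dots> = of_real (real (card ?X) * (\<Sum>n | n \<in> {1..N} \<and> [b * n = 1] (mod m). mangoldt n / real n))"
      by (simp add: sum_distrib_left)
    finally have "of_real (real (card ?X) * (\<Sum>n | n \<in> {1..N} \<and> [b * n = 1] (mod m). mangoldt n / real n))
        - (\<Sum>\<phi>\<in>?X. \<phi> b * of_real (mangoldt_coeff m \<phi>)) * of_real (ln (real N))
      = (\<Sum>\<phi>\<in>?X. \<phi> b * ((\<Sum>n=1..N. \<phi> n * of_real (mangoldt n / real n)) - of_real (mangoldt_coeff m \<phi> * ln (real N))))"
      by (simp add: right_diff_distrib sum_subtractf sum_distrib_right mult.assoc)
    also have "norm \<dots> \<le> (\<Sum>\<phi>\<in>?X. 1 * C \<phi>)"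
    proof (intro sum_norm_le)
      fix \<phi> assume "\<phi> \<in> ?X"
      thus "norm (\<phi> b * ((\<Sum>n=1..N. \<phi> n * of_real (mangoldt n / real n)) - of_real (mangoldt_coeff m \<phi> * ln (real N)))) \<le> 1 * C \<phi>"
        unfolding norm_mult using m N by (intro mult_mono norm_dchar_le C) auto
    qed
    finally show ?thesis by simp
  qed
  thus ?thesis by blast
qed

lemma not_ln_bounded: "\<not> (\<forall>N>0. ln (real N) \<le> C)"
proof
  assume bounded: "\<forall>N>0. ln (real N) \<le> C"
  have "eventually (\<lambda>N. ln (real N) \<le> C) sequentially"
    by (rule eventually_mono[OF eventually_gt_at_top[of "0 :: nat"]]) (simp add: bounded)
  moreover have "filterlim (\<lambda>N. ln (real N)) at_top sequentially" by real_asymp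
  hence "eventually (\<lambda>N. ln (real N) > C) sequentially"
    by (simp add: filterlim_at_top_dense)
  ultimately have "eventually (\<lambda>N. False) sequentially" by eventually_elim simp
  thus False by simp
qed

text \<open>
  For the residue 1 the sum over primes is nonnegative, which leaves room for at most one character
  with \<open>L(1) = 0\<close>; a non-real one would come together with its conjugate.
\<close>
theorem dirichlet_L1_nonzero:
  assumes "odd m" and \<phi>: "dchar m \<phi>" "\<phi> \<noteq> principal_dchar m"
  shows "dirichlet_L1 \<phi> \<noteq> 0"
proof
  assume zero: "dirichlet_L1 \<phi> = 0"
  have m: "m > 0" using assms(1) by (auto intro!: Nat.gr0I)
  define \<psi> where "\<psi> a = cnj (\<phi> a)" for a
  let ?X = "{\<phi>. dchar m \<phi>}"
  have \<psi>: "dchar m \<psi>" unfolding \<psi>_def by (rule dchar_cnj[OF \<phi>(1)])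
  have "\<psi> \<noteq> \<phi>"
    using dirichlet_L1_real_nonzero[OF \<phi>(1) m \<phi>(2)] zero unfolding \<psi>_def by metis
  have "\<psi> \<noteq> principal_dchar m"
  proof
    assume "\<psi> = principal_dchar m"
    hence "cnj (\<phi> a) = principal_dchar m a" for a by (metis \<psi>_def)
    hence "\<phi> a = cnj (principal_dchar m a)" for a by (metis complex_cnj_cnj)
    thus False using \<phi>(2) by (auto simp: principal_dchar_def)
  qed
  have "dirichlet_L1 \<psi> = 0"
    using dirichlet_L1_cnj[OF \<phi>(1) m \<phi>(2)] zero unfolding \<psi>_def by simp
  define D where "D = (\<Sum>\<phi>\<in>?X. mangoldt_coeff m \<phi>)"
  \<comment> \<open>Only the principal character has a positive coefficient, so the others may be
    dropped; the three kept give 1 - 1 - 1.\<close>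
  have "D \<le> (\<Sum>\<theta>\<in>{principal_dchar m, \<phi>, \<psi>}. mangoldt_coeff m \<theta>)"
  proof -
    have sub: "{principal_dchar m, \<phi>, \<psi>} \<subseteq> ?X" using \<phi> \<psi> dchar_principal[OF m] by auto
    have "D = (\<Sum>\<theta>\<in>?X - {principal_dchar m, \<phi>, \<psi>}. mangoldt_coeff m \<theta>) + (\<Sum>\<theta>\<in>{principal_dchar m, \<phi>, \<psi>}. mangoldt_coeff m \<theta>)"
      unfolding D_def by (rule sum.subset_diff[OF sub finite_dchars[OF m]])
    moreover have "(\<Sum>\<theta>\<in>?X - {principal_dchar m, \<phi>, \<psi>}. mangoldt_coeff m \<theta>) \<le> 0"
      by (intro sum_nonpos) (auto simp: mangoldt_coeff_def)
    ultimately show ?thesis by simp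
  qed
  also have "\<dots> = -1"
    using \<open>\<psi> \<noteq> \<phi>\<close> \<open>\<psi> \<noteq> principal_dchar m\<close> \<phi>(2) zero \<open>dirichlet_L1 \<psi> = 0\<close>
    by (auto simp: mangoldt_coeff_def)
  finally have D: "D \<le> -1" .
  obtain C where C: "\<And>N. N > 0 \<Longrightarrow> norm (of_real (real (card ?X) * (\<Sum>n | n \<in> {1..N} \<and> [1 * n = 1] (mod m). mangoldt n / real n))
      - (\<Sum>\<phi>\<in>?X. \<phi> 1 * of_real (mangoldt_coeff m \<phi>)) * of_real (ln (real N))) \<le> C"
    using sum_mangoldt_residue_asymp[OF assms(1), of 1] by blast
  have "ln (real N) \<le> C" if "N > 0" for N
  proof -
    define S where "S = real (card ?X) * (\<Sum>n | n \<in> {1..N} \<and> [1 * n = 1] (mod m). mangoldt n / real n)"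
    have "S \<ge> 0" unfolding S_def by (intro mult_nonneg_nonneg sum_nonneg) (auto simp: mangoldt_nonneg)
    have "(\<Sum>\<phi>\<in>?X. \<phi> 1 * of_real (mangoldt_coeff m \<phi>)) = of_real D"
      unfolding D_def of_real_sum by (intro sum.cong refl) (simp add: dchar_1)
    hence "norm (of_real S - of_real D * of_real (ln (real N)) :: complex) \<le> C"
      using C[OF that] unfolding S_def by simp
    hence "\<bar>S - D * ln (real N)\<bar> \<le> C"
      by (simp only: of_real_mult [symmetric] of_real_diff [symmetric] norm_of_real)
    moreover have "D * ln (real N) \<le> - 1 * ln (real N)"
      using D that by (intro mult_right_mono) auto
    ultimately show ?thesis using \<open>S \<ge> 0\<close> by linarith
  qed
  thus False using not_ln_bounded by blast
qed

text \<open>With only finitely many such primes, the sum of \<open>mangoldt n / n\<close> over the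
  residue class would be bounded. But every nonprincipal coefficient is now 0, so that sum times the
  number of characters is \<open>ln N\<close> up to a bounded error.\<close>

theorem dirichlet_primes_odd_modulus:
  fixes a m :: nat
  assumes "odd m" "coprime a m"
  shows "infinite {p. prime p \<and> [p = a] (mod m)}"
proof
  assume fin: "finite {p. prime p \<and> [p = a] (mod m)}"
  have m: "m > 0" using assms(1) by (auto intro!: Nat.gr0I)
  let ?X = "{\<phi>. dchar m \<phi>}"
  obtain b where b: "[a * b = 1] (mod m)" using cong_solve_coprime_nat[OF assms(2)] by auto
  have b_iff: "[b * n = 1] (mod m) \<longleftrightarrow> [n = a] (mod m)" for n
  proof
    assume "[b * n = 1] (mod m)"
    hence "[a * (b * n) = a * 1] (mod m)" by (rule cong_scalar_left)
    moreover have "[a * b * n = 1 * n] (mod m)" using b by (rule cong_scalar_right)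
    ultimately show "[n = a] (mod m)" by (simp add: cong_def mult.assoc)
  next
    assume "[n = a] (mod m)"
    hence "[b * n = b * a] (mod m)" by (rule cong_scalar_left)
    thus "[b * n = 1] (mod m)" using b by (metis cong_trans mult.commute)
  qed
  have "coprime b m" using b by (metis cong_imp_coprime cong_sym coprime_1_left coprime_mult_left_iff)
  have "(\<Sum>\<phi>\<in>?X. \<phi> b * of_real (mangoldt_coeff m \<phi>)) = (\<Sum>\<phi>\<in>{principal_dchar m}. \<phi> b * of_real (mangoldt_coeff m \<phi>))"
    using finite_dchars[OF m] dchar_principal[OF m] dirichlet_L1_nonzero[OF assms(1)]
    by (intro sum.mono_neutral_right) (auto simp: mangoldt_coeff_def)
  also have "\<dots> = 1" using \<open>coprime b m\<close> by (simp add: mangoldt_coeff_def principal_dchar_def)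
  finally have coeff: "(\<Sum>\<phi>\<in>?X. \<phi> b * of_real (mangoldt_coeff m \<phi>)) = 1" .
  obtain C where C: "\<And>N. N > 0 \<Longrightarrow> norm (of_real (real (card ?X) * (\<Sum>n | n \<in> {1..N} \<and> [b * n = 1] (mod m). mangoldt n / real n))
      - 1 * of_real (ln (real N)) :: complex) \<le> C"
    using sum_mangoldt_residue_asymp[OF assms(1), of b] unfolding coeff by blast
  obtain K where K: "\<And>N. (\<Sum>n | n \<in> {1..N} \<and> \<not> prime n. mangoldt n / real n) \<le> (K :: real)"
    using mangoldt_nonprime_sum_bounded by blast
  define E where "E = (\<Sum>p | prime p \<and> [p = a] (mod m). mangoldt p / real p :: real)"
  have "ln (real N) \<le> real (card ?X) * (K + E) + C" if "N > 0" for N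
  proof -
    define S where "S = (\<Sum>n | n \<in> {1..N} \<and> [b * n = 1] (mod m). mangoldt n / real n :: real)"
    have "S \<le> (\<Sum>n\<in>{n. n \<in> {1..N} \<and> \<not> prime n} \<union> {p. prime p \<and> [p = a] (mod m)}. mangoldt n / real n)"
      unfolding S_def b_iff using fin by (intro sum_mono2) (auto simp: mangoldt_nonneg)
    also have "\<dots> = (\<Sum>n | n \<in> {1..N} \<and> \<not> prime n. mangoldt n / real n) + E"
      unfolding E_def using fin by (intro sum.union_disjoint) auto
    also have "\<dots> \<le> K + E" using K by simp
    finally have "real (card ?X) * S \<le> real (card ?X) * (K + E)" by (intro mult_left_mono) auto
    moreover have "norm (of_real (real (card ?X) * S) - 1 * of_real (ln (real N)) :: complex) \<le> C"
      using C[OF that] unfolding S_def .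
    hence "\<bar>real (card ?X) * S - ln (real N)\<bar> \<le> C"
      by (simp only: mult_1 of_real_diff [symmetric] norm_of_real)
    ultimately show ?thesis by linarith
  qed
  thus False using not_ln_bounded by blast
qed

section \<open>The covering system\<close>

lemma cong_power_mod_expI: "mod_exp a e n = b mod n \<Longrightarrow> [a ^ e = b] (mod n)"
  by (simp add: mod_exp_def cong_def)

lemma prime_65537: "prime (65537 :: nat)"
proof (rule pocklington_alt)
  show "(65537 :: nat) - 1 = 65536 * 1" by simp
  show "[3 ^ (65537 - 1) = 1] (mod (65537 :: nat))" by (rule cong_power_mod_expI) simp
  show "\<forall>p :: nat. prime p \<and> p dvd 65536 \<longrightarrow>
      (\<exists>b :: nat. [3 ^ ((65537 - 1) div p) = b] (mod 65537) \<and> coprime (b - 1) 65537)"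
  proof (intro allI impI)
    fix p :: nat assume p: "prime p \<and> p dvd 65536"
    have "(65536 :: nat) = 2 ^ 16" by simp
    hence "p = 2" using p by (metis prime_dvd_power_nat primes_dvd_imp_eq two_is_prime_nat)
    \<comment> \<open>Pepin's test: the power of 3 is -1 modulo the Fermat number, written as
      65536.\<close>
    have "[3 ^ 32768 = 65536] (mod (65537 :: nat))" by (rule cong_power_mod_expI) simp
    moreover have "(65537 - 1) div p = 32768" using \<open>p = 2\<close> by simp
    moreover have "coprime (65536 - 1) (65537 :: nat)"
      by (simp add: coprime_iff_gcd_eq_1 gcd_non_0_nat)
    ultimately show "\<exists>b :: nat. [3 ^ ((65537 - 1) div p) = b] (mod 65537) \<and> coprime (b - 1) 65537"
      by metis
  qed
qed auto

lemma prime_nat_trial_division: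
  fixes n k :: nat
  assumes "1 < n" "n < k ^ 2" "\<forall>d\<in>set [2..<k]. \<not> d dvd n"
  shows "prime n"
proof (rule prime_prime_factor_sqrt[THEN iffD2], intro conjI notI)
  assume "\<exists>p. prime p \<and> p dvd n \<and> p\<^sup>2 \<le> n"
  then obtain p where p: "prime p" "p dvd n" "p ^ 2 \<le> n" by blast
  have "p < k" using p(3) assms(2) by (meson le_less_trans power_less_imp_less_base zero_le)
  thus False using p assms(3) prime_ge_2_nat[OF p(1)] by auto
qed (use assms in auto)

text \<open>An auxiliary certificate: 17449 is the large prime factor of 6700417 - 1. Its own
  certificate rests on the prime 727, which exceeds the square root of 17449.\<close>

lemma prime_17449: "prime (17449 :: nat)"
proof (rule pocklington_alt)
  have prime: "prime (727 :: nat)" by (rule prime_nat_trial_division[of _ 27]) simp_all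
  show "(17449 :: nat) - 1 = 727 * 24" by simp
  show "[2 ^ (17449 - 1) = 1] (mod (17449 :: nat))" by (rule cong_power_mod_expI) simp
  show "\<forall>p :: nat. prime p \<and> p dvd 727 \<longrightarrow>
      (\<exists>b :: nat. [2 ^ ((17449 - 1) div p) = b] (mod 17449) \<and> coprime (b - 1) 17449)"
  proof (intro allI impI)
    fix p :: nat assume p: "prime p \<and> p dvd 727"
    hence "p = 727" using prime primes_dvd_imp_eq by blast
    have "[2 ^ 24 = 8727] (mod (17449 :: nat))" by (rule cong_power_mod_expI) simp
    moreover have "(17449 - 1) div p = 24" using \<open>p = 727\<close> by simp
    moreover have "coprime (8727 - 1) (17449 :: nat)"
      by (simp add: coprime_iff_gcd_eq_1 gcd_non_0_nat)
    ultimately show "\<exists>b :: nat. [2 ^ ((17449 - 1) div p) = b] (mod 17449) \<and> coprime (b - 1) 17449"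
      by metis
  qed
qed auto

lemma prime_6700417: "prime (6700417 :: nat)"
proof (rule pocklington_alt)
  show "(6700417 :: nat) - 1 = 17449 * 384" by simp
  show "[3 ^ (6700417 - 1) = 1] (mod (6700417 :: nat))" by (rule cong_power_mod_expI) simp
  \<comment> \<open>Since 17449 exceeds the square root of 6700417, it suffices as the factored
    part, and a single prime divisor has to be tested.\<close>
  show "\<forall>p :: nat. prime p \<and> p dvd 17449 \<longrightarrow>
      (\<exists>b :: nat. [3 ^ ((6700417 - 1) div p) = b] (mod 6700417) \<and> coprime (b - 1) 6700417)"
  proof (intro allI impI)
    fix p :: nat assume p: "prime p \<and> p dvd 17449"
    hence "p = 17449" using prime_17449 primes_dvd_imp_eq by blast
    have "[3 ^ 384 = 5846540] (mod (6700417 :: nat))" by (rule cong_power_mod_expI) simp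
    moreover have "(6700417 - 1) div p = 384" using \<open>p = 17449\<close> by simp
    moreover have "coprime (5846540 - 1) (6700417 :: nat)"
      by (simp add: coprime_iff_gcd_eq_1 gcd_non_0_nat)
    ultimately show "\<exists>b :: nat. [3 ^ ((6700417 - 1) div p) = b] (mod 6700417) \<and> coprime (b - 1) 6700417"
      by metis
  qed
qed auto

text \<open>The prime \<open>p\<close> divides the factor of some prime \<open>q\<close>, and this
  factor divides \<open>2 ^ \<alpha> * p\<close>, so what is left after removing \<open>p\<close> is
  a power of 2. If \<open>p\<close> divides the power of \<open>q\<close>, then \<open>q = p\<close>
  and \<open>p - r\<close> is such a cofactor; otherwise \<open>q - r\<close> is \<open>p\<close>
  times a power of 2.\<close>

lemma schemmel_eq_two_power_times_prime:
  assumes "schemmel r n = 2 ^ \<alpha> * p" "prime p" "p \<noteq> 2"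
  shows "(\<exists>a. prime (2 ^ a * p + r)) \<or> (\<exists>a. p = 2 ^ a + r)"
proof -
  define f where "f q = (if q \<le> r then 0 else q ^ (multiplicity q n - 1) * (q - r))" for q
  have prod: "(\<Prod>q\<in>prime_factors n. f q) = 2 ^ \<alpha> * p"
    using assms(1) by (simp add: schemmel_def f_def)
  have "p > 0" using assms(2) by (simp add: prime_gt_0_nat)
  have "p dvd (\<Prod>q\<in>prime_factors n. f q)" unfolding prod by simp
  then obtain q where q: "q \<in> prime_factors n" "p dvd f q"
    using assms(2) by (auto simp: prime_dvd_prod_iff)
  have fq: "f q dvd 2 ^ \<alpha> * p"
    unfolding prod [symmetric] using q(1) by (intro dvd_prodI) auto
  have "f q \<noteq> 0" using fq \<open>p > 0\<close> by (intro notI) simp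
  hence "r < q" and f: "f q = q ^ (multiplicity q n - 1) * (q - r)"
    by (auto simp: f_def split: if_splits)
  have "prime q" using q(1) by auto
  have two_power: "\<exists>a. t = 2 ^ a" if "p * t dvd 2 ^ \<alpha> * p" for t
  proof -
    have "t dvd 2 ^ \<alpha>" using that \<open>p > 0\<close> by (simp add: mult.commute)
    thus ?thesis by (auto simp: divides_primepow_nat)
  qed
  consider "p dvd q ^ (multiplicity q n - 1)" | "p dvd q - r"
    using q(2) f assms(2) by (auto simp: prime_dvd_mult_iff)
  thus ?thesis
  proof cases
    case 1
    hence "p = q" using assms(2) \<open>prime q\<close> by (metis prime_dvd_power primes_dvd_imp_eq)
    with 1 have "p * (p - r) dvd f q"
      unfolding f by (intro mult_dvd_mono) auto
    then obtain a where "p - r = 2 ^ a" using two_power fq dvd_trans by blast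
    hence "p = 2 ^ a + r" using \<open>r < q\<close> \<open>p = q\<close> by simp
    thus ?thesis by blast
  next
    case 2
    then obtain t where t: "q - r = p * t" by auto
    have "p * t dvd f q" unfolding f t by simp
    then obtain a where "t = 2 ^ a" using two_power fq dvd_trans by blast
    hence "q = 2 ^ a * p + r" using t \<open>r < q\<close> by (simp add: mult.commute)
    thus ?thesis using \<open>prime q\<close> by blast
  qed
qed

lemma succ_dvd_odd_power_succ:
  fixes x :: nat
  assumes "odd u"
  shows "x + 1 dvd x ^ u + 1"
proof -
  obtain t where u: "u = 2 * t + 1" using assms by (elim oddE) auto
  have "int x + 1 dvd int x ^ (2 * t + 1) + 1" for t
  proof (induction t)
    case (Suc t)
    \<comment> \<open>The correction term is \<open>x ^ 2 - 1\<close>; the detour through the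
      integers makes the subtractions harmless.\<close>
    have "int x ^ (2 * Suc t + 1) + 1 = int x ^ 2 * (int x ^ (2 * t + 1) + 1) - (int x + 1) * (int x - 1)"
      by (simp add: algebra_simps power2_eq_square)
    thus ?case using Suc by (metis dvd_diff dvd_mult dvd_triv_left)
  qed auto
  from this[of t] have "int (x + 1) dvd int (x ^ u + 1)" by (simp add: u add.commute)
  thus ?thesis by (simp only: int_dvd_int_iff)
qed

text \<open>
  Writing a positive exponent as an odd multiple of \<open>2 ^ i\<close>, each \<open>i < 6\<close> is handled by a prime
  factor of the Fermat number \<open>2 ^ 2 ^ i + 1\<close>.  The remaining multiples of 64 are handled by 641, the
  other prime factor of the fifth Fermat number.
\<close>
lemma covering_system:
  fixes p r :: nat
  assumes "p > r" "\<forall>q\<in>{3, 5, 17, 257, 65537, 6700417}. [p = r] (mod q)" "641 dvd p + r"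
  shows "\<exists>q\<in>{3, 5, 17, 257, 641, 65537, 6700417}. q dvd 2 ^ a * p + r"
proof (cases "64 dvd a")
  case True
  then obtain t where t: "a = 64 * t" by auto
  \<comment> \<open>As 641 divides \<open>2 ^ 32 + 1\<close>, it divides
    \<open>2 ^ 64 - 1\<close>.\<close>
  have "[2 ^ 64 = 1] (mod (641 :: nat))" by (simp add: cong_def)
  hence "[(2 ^ 64) ^ t = 1 ^ t] (mod (641 :: nat))" by (rule cong_pow)
  hence "[2 ^ a = 1] (mod (641 :: nat))" by (simp add: t power_mult)
  hence "[2 ^ a * p + r = 1 * p + r] (mod 641)" by (intro cong_add cong_mult cong_refl)
  hence "641 dvd 2 ^ a * p + r" using assms(3) cong_dvd_iff by (metis mult_1)
  thus ?thesis by blast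
next
  case False
  hence "a \<noteq> 0" by (intro notI) simp
  then obtain u where u: "a = 2 ^ multiplicity 2 a * u" "odd u"
    using multiplicity_decompose'[of a 2] by auto
  define i where "i = multiplicity 2 a"
  have "i < 6"
  proof (rule ccontr)
    assume "\<not> i < 6"
    hence "(2 :: nat) ^ 6 dvd 2 ^ i" by (intro le_imp_power_dvd) simp
    hence "64 dvd a" using u(1) by (simp add: i_def) (metis dvd_mult2)
    with False show False ..
  qed
  hence "i \<in> {0, 1, 2, 3, 4, 5}" by auto
  hence "\<exists>q\<in>{3, 5, 17, 257, 65537, 6700417}. q dvd 2 ^ 2 ^ i + (1 :: nat)" by auto
  then obtain q where q: "q \<in> {3, 5, 17, 257, 65537, 6700417}" "q dvd 2 ^ 2 ^ i + (1 :: nat)" by blast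
  have "2 ^ 2 ^ i + 1 dvd (2 ^ 2 ^ i) ^ u + (1 :: nat)" by (rule succ_dvd_odd_power_succ[OF u(2)])
  hence "q dvd 2 ^ a + 1"
    using q(2) dvd_trans u(1) unfolding i_def by (metis power_mult)
  moreover have "q dvd p - r"
    using assms(1,2) q(1) by (auto simp: cong_altdef_nat)
  moreover have "2 ^ a * p + r = (2 ^ a + 1) * p - (p - r)"
    using assms(1) by (simp add: algebra_simps)
  ultimately have "q dvd 2 ^ a * p + r" by (metis dvd_diff_nat dvd_mult2)
  thus ?thesis using q(1) by auto
qed

theorem theorem3p3:
  fixes r :: nat
  assumes "r > 0" and "odd r"
    and "\<forall>q\<in>{3, 5, 17, 257, 641, 65537, 6700417}. \<not> q dvd r"
  shows "infinite {p. prime p \<and> (\<forall>\<alpha>::nat. 2 ^ \<alpha> * p \<in> schemmel_G r)}"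
proof -
  let ?Q = "{3, 5, 17, 257, 65537, 6700417} :: nat set"
  define Q :: nat where "Q = 3 * 5 * 17 * 257 * 65537 * 6700417"
  have "prime (3 :: nat)" "prime (5 :: nat)" "prime (17 :: nat)" by simp_all
  moreover have "prime (257 :: nat)" by (rule prime_nat_trial_division[of _ 17]) simp_all
  moreover have "prime (641 :: nat)" by (rule prime_nat_trial_division[of _ 26]) simp_all
  ultimately have primes: "prime q" if "q \<in> insert 641 ?Q" for q
    using that prime_65537 prime_6700417 by blast
  \<comment> \<open>The indivisibility assumptions on \<open>r\<close> enter here: they make the
    prescribed residue a unit, so that Dirichlet's theorem applies.\<close>
  have co: "coprime r q" if "q \<in> insert 641 ?Q" for q
    using prime_imp_coprime[OF primes[OF that]] that assms(3) by (auto simp: coprime_commute)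
  have "coprime Q 641" unfolding Q_def by (simp add: coprime_iff_gcd_eq_1 gcd_non_0_nat)
  \<comment> \<open>The factor 640 stands for -1 modulo 641, so \<open>x + r\<close> is divisible by
    641.\<close>
  then obtain x where x: "[x = r] (mod Q)" "[x = 640 * r] (mod 641)"
    using binary_chinese_remainder_nat by blast
  have "coprime x Q"
  proof -
    have "coprime r Q" unfolding Q_def coprime_mult_right_iff by (intro conjI co) auto
    thus ?thesis using x(1) by (metis cong_imp_coprime cong_sym)
  qed
  moreover have "coprime x 641"
  proof -
    have "coprime 640 (641 :: nat)" by (simp add: coprime_iff_gcd_eq_1 gcd_non_0_nat)
    hence "coprime (640 * r) 641" using co[of 641] by simp
    thus ?thesis using x(2) by (metis cong_imp_coprime cong_sym)
  qed
  ultimately have "coprime x (Q * 641)" by simp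
  moreover have "odd (Q * 641)" by (simp add: Q_def)
  ultimately have "infinite {p. prime p \<and> [p = x] (mod (Q * 641))}"
    by (intro dirichlet_primes_odd_modulus)
  \<comment> \<open>Discarding small \<open>p\<close> makes \<open>2 ^ a * p + r\<close> exceed
    every covering prime, so divisibility by one of them means compositeness; it also ensures
    \<open>p > r\<close>.\<close>
  hence "infinite ({p. prime p \<and> [p = x] (mod (Q * 641))} - {..6700417 + r})"
    by (rule Diff_infinite_finite[rotated]) simp
  moreover have "{p. prime p \<and> [p = x] (mod (Q * 641))} - {..6700417 + r}
      \<subseteq> {p. prime p \<and> (\<forall>\<alpha>::nat. 2 ^ \<alpha> * p \<in> schemmel_G r)}"
  proof
    fix p assume "p \<in> {p. prime p \<and> [p = x] (mod (Q * 641))} - {..6700417 + r}"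
    hence p: "prime p" "[p = x] (mod (Q * 641))" "p > 6700417 + r" by auto
    have "[p = r] (mod Q)"
      using p(2) x(1) by (metis cong_dvd_modulus_nat cong_trans dvd_triv_left)
    hence pQ: "[p = r] (mod q)" if "q \<in> ?Q" for q
      by (rule cong_dvd_modulus_nat) (use that in \<open>auto simp: Q_def\<close>)
    have "[p = 640 * r] (mod 641)"
      using p(2) x(2) by (metis cong_dvd_modulus_nat cong_trans dvd_triv_right)
    hence "[p + r = 640 * r + r] (mod 641)" by (rule cong_add) simp
    hence "641 dvd p + r" by (simp add: cong_dvd_iff)
    have composite: "\<not> prime (2 ^ a * p + r)" for a
    proof
      assume prime: "prime (2 ^ a * p + r)"
      obtain q where q: "q \<in> {3, 5, 17, 257, 641, 65537, 6700417}" "q dvd 2 ^ a * p + r"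
        using covering_system[of r p a] p(3) pQ \<open>641 dvd p + r\<close> by auto
      have "q \<noteq> 1" "q \<le> 6700417" using q(1) by auto
      hence "q = 2 ^ a * p + r" using prime q(2) by (metis prime_nat_iff)
      moreover have "p \<le> 2 ^ a * p" by simp
      ultimately show False using \<open>q \<le> 6700417\<close> p(3) by linarith
    qed
    have no_power: "p \<noteq> 2 ^ a + r" for a
    proof
      assume "p = 2 ^ a + r"
      moreover have "3 dvd p - r" using pQ[of 3] p(3) by (simp add: cong_altdef_nat)
      ultimately have "3 dvd (2 :: nat) ^ a" by simp
      hence "(3 :: nat) dvd 2" by (rule prime_dvd_power[rotated]) simp
      thus False by simp
    qed
    have "p \<noteq> 2" using p(3) by simp
    hence "schemmel r n \<noteq> 2 ^ \<alpha> * p" for n \<alpha>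
      using schemmel_eq_two_power_times_prime[of r n \<alpha> p] p(1) composite no_power by blast
    thus "p \<in> {p. prime p \<and> (\<forall>\<alpha>::nat. 2 ^ \<alpha> * p \<in> schemmel_G r)}"
      using p(1) by (simp add: schemmel_G_def prime_gt_0_nat)
  qed
  ultimately show ?thesis using infinite_super by blast
qed

end
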